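(* Let $X$ and $U$ be Banach spaces, let $A:D(A)\subset X\to X$ be the infinitesimal generator of a strongly continuous semigroup on $X$ with nonempty resolvent set, let $B\in L(U,X_{-1})$, and let $\mathcal U:=L_p(\mathbb R_+,U)$ for some $p\in[1,+\infty)$. Then the linear system $\dot x(t)=Ax(t)+Bu(t)$, $t>0$, is input-to-state stable (ISS) with respect to $\mathcal U$ if and only if it is integral input-to-state stable (iISS) with respect to $\mathcal U$.
   Context: $\mathbb R_+=[0,\infty)$; $L_p(\mathbb R_+,U)$ is the Bochner–Lebesgue space. $T=(T(t))_{t\ge0}$ denotes the semigroup generated by $A$. The extrapolation space $X_{-1}$ is the completion of $X$ with respect to the norm $\|x\|_{X_{-1}}:=\|(aI-A)^{-1}x\|_X$ for some $a$ in the resolvent set of $A$; $T$ extends uniquely to a strongly continuous semigroup $T_{-1}$ on $X_{-1}$, whose generator $A_{-1}$ extends $A$ and has domain $X$. $L(U,X_{-1})$ is the space of bounded linear operators. The mild solution is $\phi(t,x,u)=T(t)x+\int_0^tT_{-1}(t-s)Bu(s)\,ds$ (Bochner integral in $X_{-1}$). The operator $B$ is $p$-admissible if there is $t>0$ such that $\int_0^tT_{-1}(t-s)Bu(s)\,ds\in X$ for all $u\in L_p(\mathbb R_+,U)$; then this holds for every $t>0$. Both ISS and iISS are properties of forward complete systems, i.e. each of them includes the requirement that $\phi(t,x,u)\in X$ for all $t\ge0$, $x\in X$, $u\in\mathcal U$ (that is, $B$ is $p$-admissible). Comparison functions: $\mathcal K$ is the set of continuous strictly increasing $\gamma:\mathbb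 R_+\to\mathbb R_+$ with $\gamma(0)=0$; $\mathcal K_\infty$ is the set of unbounded $\gamma\in\mathcal K$; $\mathcal{KL}$ is the set of continuous $\beta:\mathbb R_+\times\mathbb R_+\to\mathbb R_+$ with $\beta(\cdot,t)\in\mathcal K$ for all $t\ge0$ and $\beta(r,\cdot)$ strictly decreasing with limit $0$ for all $r>0$. ISS: there exist $\beta\in\mathcal{KL}$, $\gamma\in\mathcal K_\infty$ such that $\|\phi(t,x,u)\|_X\le\beta(\|x\|_X,t)+\gamma(\|u\|_{\mathcal U})$ for all $x\in X$, $u\in\mathcal U$, $t\ge0$. iISS: there exist $\theta\in\mathcal K_\infty$, $\mu\in\mathcal K$, $\beta\in\mathcal{KL}$ such that $\|\phi(t,x,u)\|_X\le\beta(\|x\|_X,t)+\theta\big(\int_0^t\mu(\|u(s)\|_U)\,ds\big)$ for all $x\in X$, $u\in\mathcal U$, $t\ge0$, where a divergent integral is interpreted as making the right-hand side $+\infty$. *)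

theory Defs
  imports "HOL-Analysis.Analysis"
begin

section \<open>Bochner integration in arbitrary Banach spaces\<close>

text \<open>
  The library's Bochner integral is restricted to second-countable (that is, separable) target
  spaces. The definitions below reuse its simple functions and their integrals, which are not
  restricted in this way, and replace Borel measurability by strong measurability.
\<close>

definition strongly_measurable :: "'s measure \<Rightarrow> ('s \<Rightarrow> 'e::real_normed_vector) \<Rightarrow> bool" where
  "strongly_measurable M f \<longleftrightarrow>
     (\<exists>s. (\<forall>i::nat. simple_function M (s i)) \<and> (AE x in M. (\<lambda>i. s i x) \<longlonglongrightarrow> f x))"

definition has_banach_integral ::
    "'s measure \<Rightarrow> ('s \<Rightarrow> 'e::real_normed_vector) \<Rightarrow> 'e \<Rightarrow> bool" where
  "has_banach_integral M f z \<longleftrightarrow>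
     strongly_measurable M f \<and>
     (\<exists>s. (\<forall>i::nat. Bochner_Integration.simple_bochner_integrable M (s i)) \<and>
          (\<lambda>i. \<integral>\<^sup>+x. ennreal (norm (f x - s i x)) \<partial>M) \<longlonglongrightarrow> 0 \<and>
          (\<lambda>i. Bochner_Integration.simple_bochner_integral M (s i)) \<longlonglongrightarrow> z)"

definition banach_integral :: "'s measure \<Rightarrow> ('s \<Rightarrow> 'e::real_normed_vector) \<Rightarrow> 'e" where
  "banach_integral M f = (THE z. has_banach_integral M f z)"

text \<open>
  Elements of \<open>L_p\<close> are represented by functions on the whole real line whose values on the
  negative reals are irrelevant; none of the notions below distinguishes functions that agree
  almost everywhere on \<open>{0..}\<close>.
\<close>

definition Lp_inputs :: "real \<Rightarrow> (real \<Rightarrow> 'u::real_normed_vector) set" where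
  "Lp_inputs p = {u. strongly_measurable (lebesgue_on {0..}) u \<and>
                     integrable (lebesgue_on {0..}) (\<lambda>s. norm (u s) powr p)}"

definition Lp_norm :: "real \<Rightarrow> (real \<Rightarrow> 'u::real_normed_vector) \<Rightarrow> real" where
  "Lp_norm p u = (integral\<^sup>L (lebesgue_on {0..}) (\<lambda>s. norm (u s) powr p)) powr (1 / p)"


section \<open>Semigroups, generators and resolvents\<close>

text \<open>A semigroup is a family indexed by \<open>real\<close>; only its members for \<open>t \<ge> 0\<close> matter.\<close>

definition C0_semigroup :: "(real \<Rightarrow> 'a::real_normed_vector \<Rightarrow>\<^sub>L 'a) \<Rightarrow> bool" where
  "C0_semigroup T \<longleftrightarrow>
     T 0 = id_blinfun \<and>
     (\<forall>s\<ge>0. \<forall>t\<ge>0. T (s + t) = T s o\<^sub>L T t) \<and>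
     (\<forall>x. ((\<lambda>t. T t x) \<longlongrightarrow> x) (at_right 0))"

text \<open>The unbounded operator \<open>A\<close> with domain \<open>D\<close> is the infinitesimal generator of \<open>T\<close>.\<close>

definition is_generator ::
    "(real \<Rightarrow> 'a::real_normed_vector \<Rightarrow>\<^sub>L 'a) \<Rightarrow> 'a set \<Rightarrow> ('a \<Rightarrow> 'a) \<Rightarrow> bool" where
  "is_generator T D A \<longleftrightarrow>
     D = {x. \<exists>y. ((\<lambda>h. (T h x - x) /\<^sub>R h) \<longlongrightarrow> y) (at_right 0)} \<and>
     (\<forall>x\<in>D. ((\<lambda>h. (T h x - x) /\<^sub>R h) \<longlongrightarrow> A x) (at_right 0))"

definition resolvent :: "'a::real_normed_vector set \<Rightarrow> ('a \<Rightarrow> 'a) \<Rightarrow> real \<Rightarrow> 'a \<Rightarrow> 'a" where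
  "resolvent D A a = inv_into D (\<lambda>x. a *\<^sub>R x - A x)"

definition resolvent_set :: "'a::real_normed_vector set \<Rightarrow> ('a \<Rightarrow> 'a) \<Rightarrow> real set" where
  "resolvent_set D A =
     {a. bij_betw (\<lambda>x. a *\<^sub>R x - A x) D UNIV \<and> bounded_linear (resolvent D A a)}"


section \<open>The extrapolation space\<close>

text \<open>
  The norm to be completed depends on \<open>A\<close>, so the completion cannot be a type constructed once
  and for all. Instead a Banach space \<open>'c\<close> together with a map \<open>j\<close> is a completion
  of \<open>X\<close> with respect to the norm \<open>\<parallel>(aI - A)\<^sup>-\<^sup>1 x\<parallel>\<close> if \<open>j\<close> is linear, isometric for this
  norm, and has dense range. Membership of \<open>z\<close> in \<open>X\<close> then reads \<open>z \<in> range j\<close>.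
\<close>

definition extrapolation_space ::
    "'a::real_normed_vector set \<Rightarrow> ('a \<Rightarrow> 'a) \<Rightarrow> real \<Rightarrow> ('a \<Rightarrow> 'c::banach) \<Rightarrow> bool" where
  "extrapolation_space D A a j \<longleftrightarrow>
     linear j \<and> (\<forall>x. norm (j x) = norm (resolvent D A a x)) \<and> closure (range j) = UNIV"

definition extrapolated_semigroup ::
    "('a::real_normed_vector \<Rightarrow> 'c::real_normed_vector) \<Rightarrow> (real \<Rightarrow> 'a \<Rightarrow>\<^sub>L 'a) \<Rightarrow> real \<Rightarrow> 'c \<Rightarrow>\<^sub>L 'c"
  where
  "extrapolated_semigroup j T t = (THE S. \<forall>x. blinfun_apply S (j x) = j (T t x))"

definition mild_solution ::
    "('a::real_normed_vector \<Rightarrow> 'c::real_normed_vector) \<Rightarrow> (real \<Rightarrow> 'a \<Rightarrow>\<^sub>L 'a) \<Rightarrow>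
     ('u::real_normed_vector \<Rightarrow>\<^sub>L 'c) \<Rightarrow> real \<Rightarrow> 'a \<Rightarrow> (real \<Rightarrow> 'u) \<Rightarrow> 'c" where
  "mild_solution j T B t x u =
     j (T t x) +
     banach_integral (lebesgue_on {0..t}) (\<lambda>s. extrapolated_semigroup j T (t - s) (B (u s)))"

text \<open>The norm of \<open>X\<close>, for those elements of the extrapolation space that belong to \<open>X\<close>.\<close>

definition X_norm :: "('a::real_normed_vector \<Rightarrow> 'c) \<Rightarrow> 'c \<Rightarrow> real" where
  "X_norm j z = norm (inv j z)"


section \<open>Comparison functions\<close>

definition class_K :: "(real \<Rightarrow> real) set" where
  "class_K = {\<gamma>. continuous_on {0..} \<gamma> \<and> strict_mono_on {0..} \<gamma> \<and> \<gamma> 0 = 0}"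

definition class_K_inf :: "(real \<Rightarrow> real) set" where
  "class_K_inf = {\<gamma> \<in> class_K. \<not> bdd_above (\<gamma> ` {0..})}"

definition class_KL :: "(real \<Rightarrow> real \<Rightarrow> real) set" where
  "class_KL = {\<beta>. continuous_on ({0..} \<times> {0..}) (\<lambda>(r, t). \<beta> r t) \<and>
                  (\<forall>t\<ge>0. (\<lambda>r. \<beta> r t) \<in> class_K) \<and>
                  (\<forall>r>0. strict_antimono_on {0..} (\<beta> r) \<and> (\<beta> r \<longlongrightarrow> 0) at_top)}"


section \<open>Stability notions\<close>

definition forward_complete ::
    "real \<Rightarrow> ('a::real_normed_vector \<Rightarrow> 'c::real_normed_vector) \<Rightarrow> (real \<Rightarrow> 'a \<Rightarrow>\<^sub>L 'a) \<Rightarrow>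
     ('u::real_normed_vector \<Rightarrow>\<^sub>L 'c) \<Rightarrow> bool" where
  "forward_complete p j T B \<longleftrightarrow>
     (\<forall>t\<ge>0. \<forall>x. \<forall>u\<in>Lp_inputs p. mild_solution j T B t x u \<in> range j)"

definition ISS ::
    "real \<Rightarrow> ('a::real_normed_vector \<Rightarrow> 'c::real_normed_vector) \<Rightarrow> (real \<Rightarrow> 'a \<Rightarrow>\<^sub>L 'a) \<Rightarrow>
     ('u::real_normed_vector \<Rightarrow>\<^sub>L 'c) \<Rightarrow> bool" where
  "ISS p j T B \<longleftrightarrow>
     forward_complete p j T B \<and>
     (\<exists>\<beta>\<in>class_KL. \<exists>\<gamma>\<in>class_K_inf. \<forall>x. \<forall>u\<in>Lp_inputs p. \<forall>t\<ge>0.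
        X_norm j (mild_solution j T B t x u) \<le> \<beta> (norm x) t + \<gamma> (Lp_norm p u))"

text \<open>
  The integral of \<open>\<mu> (norm (u s))\<close> may diverge, in which case the estimate holds vacuously; the
  integrand is nonnegative and measurable, so integrability means that the integral is finite.
\<close>

definition iISS ::
    "real \<Rightarrow> ('a::real_normed_vector \<Rightarrow> 'c::real_normed_vector) \<Rightarrow> (real \<Rightarrow> 'a \<Rightarrow>\<^sub>L 'a) \<Rightarrow>
     ('u::real_normed_vector \<Rightarrow>\<^sub>L 'c) \<Rightarrow> bool" where
  "iISS p j T B \<longleftrightarrow>
     forward_complete p j T B \<and>
     (\<exists>\<theta>\<in>class_K_inf. \<exists>\<mu>\<in>class_K. \<exists>\<beta>\<in>class_KL. \<forall>x. \<forall>u\<in>Lp_inputs p. \<forall>t\<ge>0.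
        integrable (lebesgue_on {0..t}) (\<lambda>s. \<mu> (norm (u s))) \<longrightarrow>
        X_norm j (mild_solution j T B t x u)
          \<le> \<beta> (norm x) t + \<theta> (integral\<^sup>L (lebesgue_on {0..t}) (\<lambda>s. \<mu> (norm (u s)))))"

end

theory Submission
  imports Defs
begin

text \<open>
  If the system is ISS, then causality and linearity turn the gain into a bound by a multiple of the
  \<open>L\<^sub>p\<close>-norm of the input on \<open>[0, t]\<close>, which is an iISS estimate with \<open>\<mu> r = r\<^sup>p\<close> and
  \<open>\<theta> r = c r\<^sup>1\<^sup>/\<^sup>p\<close>. Conversely, iISS says nothing about inputs for which \<open>\<mu> (\<parallel>u\<parallel>)\<close> is not
  integrable, and only two of its consequences are used: it makes the semigroup uniformly
  exponentially stable, and it includes \<open>p\<close>-admissibility. By the uniform boundedness principle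
  an admissible input map \<open>u \<mapsto> \<phi>(\<tau>, 0, u)\<close> is bounded from \<open>L\<^sub>p\<close> to \<open>X\<close>, and the cocycle property
  together with \<open>\<parallel>T(\<tau>)\<parallel> \<le> 1/2\<close> makes the bound uniform in time.
\<close>

section \<open>The Bochner integral in arbitrary Banach spaces\<close>

text \<open>The input map \<open>W t\<close> is obviously bounded from \<open>Lp_inputs p\<close>
  into the extrapolation space, while stability needs a bound in the stronger norm of
  \<open>X\<close>. The gap is closed by bounded operators \<open>S n\<close> from the extrapolation
  space to \<open>X\<close> that converge pointwise to the identity on \<open>X\<close>: each
  composition \<open>S n (W t u)\<close> is bounded in \<open>u\<close>, admissibility makes these
  compositions converge for every fixed \<open>u\<close>, and uniform boundedness then passes to the
  limit. Inputs are functions with the seminorm \<open>Lp_norm\<close>, not elements of a Banach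
  space type. Uniform boundedness is therefore proved by hand from additivity, homogeneity and the
  convergence of a geometrically small series of inputs. None of the spaces is assumed separable.
  Integrals are limits of integrals of simple functions, and measurability of norms rests on the
  completeness of Lebesgue measure. Since \<open>Lp_norm p u\<close> may vanish, homogeneity is used
  with an arbitrary \<open>c > Lp_norm p u\<close>, and \<open>dense_ge\<close> lets
  \<open>c\<close> decrease.\<close>

lemma complete_measure_restrict_space:
  assumes "complete_measure M" and "S \<in> sets M"
  shows "complete_measure (restrict_space M S)"
proof
  fix E F assume FE: "F \<subseteq> E" and E: "E \<in> null_sets (restrict_space M S)"
  have "E \<in> null_sets M" "E \<subseteq> S"
    using E assms(2) sets.sets_into_space[OF assms(2)]
    by (auto simp: null_sets_restrict_space)
  with FE have "F \<in> sets M"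
    using complete_measure.complete[OF assms(1)] by blast
  with \<open>E \<subseteq> S\<close> FE show "F \<in> sets (restrict_space M S)"
    using assms(2) sets.sets_into_space[OF assms(2)] by (auto simp: sets_restrict_space_iff Int_absorb2)
qed

lemma complete_lebesgue: "complete_measure lebesgue"
  by (rule completion.complete_measure_axioms)

lemma complete_lebesgue_on: "S \<in> sets lebesgue \<Longrightarrow> complete_measure (lebesgue_on S)"
  by (intro complete_measure_restrict_space complete_lebesgue)

text \<open>Strong measurability controls a function only up to a null set; completeness of the
  measure is what makes such a change harmless for Borel measurability.\<close>

lemma borel_measurable_AE_eq:
  assumes "complete_measure M" and g: "g \<in> borel_measurable M" and ae: "AE x in M. f x = g x"
  shows "f \<in> borel_measurable M"
proof (rule measurableI)
  fix E :: "'b set" assume "E \<in> sets borel"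
  then have "g -` E \<inter> space M \<in> sets M" using g by (rule measurable_sets[rotated])
  then show "f -` E \<inter> space M \<in> sets M"
  proof (rule complete_measure.in_sets_AE[OF assms(1), rotated])
    show "AE x in M. (x \<in> g -` E \<inter> space M) = (x \<in> f -` E \<inter> space M)"
      using ae by eventually_elim auto
  qed auto
qed simp

lemma borel_measurable_AE_limit:
  fixes f :: "'s \<Rightarrow> real"
  assumes "complete_measure M" and g: "\<And>i. g i \<in> borel_measurable M"
    and ae: "AE x in M. (\<lambda>i. g i x) \<longlonglongrightarrow> f x"
  shows "f \<in> borel_measurable M"
proof (rule borel_measurable_AE_eq[OF assms(1)])
  show "(\<lambda>x. lim (\<lambda>i. g i x)) \<in> borel_measurable M"
    using g by (rule borel_measurable_lim_metric)
  show "AE x in M. f x = lim (\<lambda>i. g i x)"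
    using ae by eventually_elim (simp add: limI)
qed

section \<open>Strong measurability\<close>

lemma strongly_measurable_simple: "simple_function M s \<Longrightarrow> strongly_measurable M s"
  unfolding strongly_measurable_def by (intro exI[of _ "\<lambda>_. s"]) simp

lemma strongly_measurable_cong_AE:
  assumes "strongly_measurable M f" and "AE x in M. f x = g x"
  shows "strongly_measurable M g"
proof -
  obtain s where s: "\<And>i::nat. simple_function M (s i)" "AE x in M. (\<lambda>i. s i x) \<longlonglongrightarrow> f x"
    using assms(1) by (auto simp: strongly_measurable_def)
  have "AE x in M. (\<lambda>i. s i x) \<longlonglongrightarrow> g x"
    using s(2) assms(2) by eventually_elim simp
  with s(1) show ?thesis by (auto simp: strongly_measurable_def)
qed

lemma strongly_measurable_add:
  assumes "strongly_measurable M f" and "strongly_measurable M g"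
  shows "strongly_measurable M (\<lambda>x. f x + g x)"
proof -
  obtain s t where s: "\<And>i::nat. simple_function M (s i)" "AE x in M. (\<lambda>i. s i x) \<longlonglongrightarrow> f x"
    and t: "\<And>i::nat. simple_function M (t i)" "AE x in M. (\<lambda>i. t i x) \<longlonglongrightarrow> g x"
    using assms by (auto simp: strongly_measurable_def)
  have "AE x in M. (\<lambda>i. s i x + t i x) \<longlonglongrightarrow> f x + g x"
    using s(2) t(2) by eventually_elim (rule tendsto_add)
  moreover have "simple_function M (\<lambda>x. s i x + t i x)" for i
    by (rule simple_function_compose2[OF s(1) t(1)])
  ultimately show ?thesis
    unfolding strongly_measurable_def by (intro exI[of _ "\<lambda>i x. s i x + t i x"]) simp
qed

lemma strongly_measurable_bounded_linear:
  assumes "bounded_linear L" and "strongly_measurable M f"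
  shows "strongly_measurable M (\<lambda>x. L (f x))"
proof -
  obtain s where s: "\<And>i::nat. simple_function M (s i)" "AE x in M. (\<lambda>i. s i x) \<longlonglongrightarrow> f x"
    using assms(2) by (auto simp: strongly_measurable_def)
  have "AE x in M. (\<lambda>i. L (s i x)) \<longlonglongrightarrow> L (f x)"
    using s(2) by eventually_elim (rule bounded_linear.tendsto[OF assms(1)])
  moreover have "simple_function M (\<lambda>x. L (s i x))" for i
    by (rule simple_function_compose1[OF s(1)])
  ultimately show ?thesis
    unfolding strongly_measurable_def by (intro exI[of _ "\<lambda>i x. L (s i x)"]) simp
qed

text \<open>Measure preservation guarantees that the null set on which the approximation fails pulls
  back to a null set.\<close>

lemma strongly_measurable_comp:
  assumes g: "g \<in> measurable M N" and "distr M N g = N" and "strongly_measurable N f"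
  shows "strongly_measurable M (\<lambda>x. f (g x))"
proof -
  obtain s where s: "\<And>i::nat. simple_function N (s i)" "AE x in N. (\<lambda>i. s i x) \<longlonglongrightarrow> f x"
    using assms(3) by (auto simp: strongly_measurable_def)
  have "AE x in distr M N g. (\<lambda>i. s i x) \<longlonglongrightarrow> f x"
    by (subst assms(2)) (rule s(2))
  then have "AE x in M. (\<lambda>i. s i (g x)) \<longlonglongrightarrow> f (g x)"
    by (rule AE_distrD[OF g])
  with simple_function_comp[OF g s(1)] show ?thesis
    unfolding strongly_measurable_def
    by (intro exI[of _ "\<lambda>i x. s i (g x)"]) simp
qed

text \<open>Moves functions on an interval to the whole line, where translations act and pieces over
  different intervals can be added.\<close>

lemma strongly_measurable_restrict_space:
  fixes f :: "'s \<Rightarrow> 'e::real_normed_vector"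
  assumes S: "S \<in> sets M"
  shows "strongly_measurable (restrict_space M S) f
     \<longleftrightarrow> strongly_measurable M (\<lambda>x. indicator S x *\<^sub>R f x)"
proof
  have S': "S \<inter> space M \<in> sets M" using S by auto
  assume "strongly_measurable (restrict_space M S) f"
  then obtain s where s: "\<And>i::nat. simple_function (restrict_space M S) (s i)"
    "AE x in restrict_space M S. (\<lambda>i. s i x) \<longlonglongrightarrow> f x"
    by (auto simp: strongly_measurable_def)
  have "AE x in M. (\<lambda>i. indicator S x *\<^sub>R s i x) \<longlonglongrightarrow> indicator S x *\<^sub>R f x"
    using s(2) unfolding AE_restrict_space_iff[OF S']
    by eventually_elim (auto simp: indicator_def)
  with s(1) show "strongly_measurable M (\<lambda>x. indicator S x *\<^sub>R f x)"
    unfolding strongly_measurable_def simple_function_restrict_space[OF S']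
    by (intro exI[of _ "\<lambda>i x. indicator S x *\<^sub>R s i x"] conjI allI)
next
  have S': "S \<inter> space M \<in> sets M" using S by auto
  assume "strongly_measurable M (\<lambda>x. indicator S x *\<^sub>R f x)"
  then obtain s where s: "\<And>i::nat. simple_function M (s i)"
    "AE x in M. (\<lambda>i. s i x) \<longlonglongrightarrow> indicator S x *\<^sub>R f x"
    by (auto simp: strongly_measurable_def)
  have "AE x in restrict_space M S. (\<lambda>i. s i x) \<longlonglongrightarrow> f x"
    using s(2) unfolding AE_restrict_space_iff[OF S']
    by eventually_elim (auto simp: indicator_def)
  moreover have "simple_function M (\<lambda>x. indicator S x *\<^sub>R s i x)" for i
    using simple_function_compose2[OF simple_function_indicator[OF S] s(1), where h="scaleR"] .
  ultimately show "strongly_measurable (restrict_space M S) f"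
    unfolding strongly_measurable_def simple_function_restrict_space[OF S'] by blast
qed

lemma strongly_measurable_indicator:
  assumes "S \<in> sets M" and "strongly_measurable M f"
  shows "strongly_measurable M (\<lambda>x. indicator S x *\<^sub>R f x)"
proof -
  obtain s where s: "\<And>i::nat. simple_function M (s i)" "AE x in M. (\<lambda>i. s i x) \<longlonglongrightarrow> f x"
    using assms(2) by (auto simp: strongly_measurable_def)
  have "AE x in M. (\<lambda>i. indicator S x *\<^sub>R s i x) \<longlonglongrightarrow> indicator S x *\<^sub>R f x"
    using s(2) by eventually_elim (intro tendsto_intros)
  moreover have "simple_function M (\<lambda>x. indicator S x *\<^sub>R s i x)" for i
    using simple_function_compose2[OF simple_function_indicator[OF assms(1)] s(1), where h="scaleR"] .
  ultimately show ?thesis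
    unfolding strongly_measurable_def by (intro exI[of _ "\<lambda>i x. indicator S x *\<^sub>R s i x"]) simp
qed

lemma strongly_measurable_norm_diff:
  assumes "complete_measure M" and "strongly_measurable M f" and "simple_function M t"
  shows "(\<lambda>x. norm (f x - t x)) \<in> borel_measurable M"
proof -
  obtain s where s: "\<And>i::nat. simple_function M (s i)" "AE x in M. (\<lambda>i. s i x) \<longlonglongrightarrow> f x"
    using assms(2) by (auto simp: strongly_measurable_def)
  show ?thesis
  proof (rule borel_measurable_AE_limit[OF assms(1)])
    show "(\<lambda>x. norm (s i x - t x)) \<in> borel_measurable M" for i
      using s(1) assms(3)
      by (intro borel_measurable_simple_function simple_function_compose2[where h="\<lambda>x y. norm (x - y)"])
    show "AE x in M. (\<lambda>i. norm (s i x - t x)) \<longlonglongrightarrow> norm (f x - t x)"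
      using s(2) by eventually_elim (intro tendsto_intros)
  qed
qed

lemma strongly_measurable_norm:
  assumes "complete_measure M" and "strongly_measurable M f"
  shows "(\<lambda>x. norm (f x)) \<in> borel_measurable M"
  using strongly_measurable_norm_diff[OF assms simple_function_const[of _ 0]] by simp

text \<open>Each approximant is cut to 0 where its norm exceeds \<open>2 * norm (f x)\<close>. Where
  \<open>f x\<close> is nonzero the cut eventually has no effect, because the factor 2 leaves room
  above the limit; where \<open>f x = 0\<close> it forces the value 0. The cut set is measurable
  because \<open>norm (f x)\<close> is.\<close>

lemma strongly_measurable_dominated:
  fixes f :: "'s \<Rightarrow> 'e::real_normed_vector"
  assumes "complete_measure M" and "strongly_measurable M f"
  obtains s where "\<And>i::nat. simple_function M (s i)" "\<And>i x. norm (s i x) \<le> 2 * norm (f x)"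
    "AE x in M. (\<lambda>i. s i x) \<longlonglongrightarrow> f x"
proof -
  obtain s where s: "\<And>i::nat. simple_function M (s i)" "AE x in M. (\<lambda>i. s i x) \<longlonglongrightarrow> f x"
    using assms(2) by (auto simp: strongly_measurable_def)
  define S where "S i = {x \<in> space M. norm (s i x) \<le> 2 * norm (f x)}" for i
  have [measurable]: "(\<lambda>x. norm (f x)) \<in> borel_measurable M" "(\<lambda>x. norm (s i x)) \<in> borel_measurable M" for i
    using strongly_measurable_norm[OF assms] s(1)
    by (auto intro: strongly_measurable_norm[OF assms(1)] strongly_measurable_simple)
  have S: "S i \<in> sets M" for i unfolding S_def by measurable
  show ?thesis
  proof
    show "simple_function M (\<lambda>x. indicator (S i) x *\<^sub>R s i x)" for i
      using simple_function_compose2[OF simple_function_indicator[OF S] s(1), where h="scaleR"] .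
    show "norm (indicator (S i) x *\<^sub>R s i x) \<le> 2 * norm (f x)" for i x
      by (auto simp: S_def indicator_def)
    show "AE x in M. (\<lambda>i. indicator (S i) x *\<^sub>R s i x) \<longlonglongrightarrow> f x"
      using s(2) AE_space
    proof eventually_elim
      case (elim x)
      show ?case
      proof (cases "f x = 0")
        case True
        then have "indicator (S i) x *\<^sub>R s i x = 0" for i
          by (auto simp: S_def indicator_def)
        then show ?thesis unfolding True by (simp only: tendsto_const)
      next
        case False
        have "(\<lambda>i. norm (s i x)) \<longlonglongrightarrow> norm (f x)" using elim(1) by (rule tendsto_norm)
        then have "eventually (\<lambda>i. norm (s i x) < 2 * norm (f x)) sequentially"
          by (rule order_tendstoD) (use False in simp)
        then have "eventually (\<lambda>i. indicator (S i) x *\<^sub>R s i x = s i x) sequentially"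
          by eventually_elim (use elim in \<open>auto simp: S_def\<close>)
        then show ?thesis using elim(1) by (simp cong: tendsto_cong)
      qed
    qed
  qed
qed

section \<open>Existence, uniqueness and calculus of the Bochner integral\<close>

lemma simple_bochner_integrable_simple_function:
  "Bochner_Integration.simple_bochner_integrable M s \<Longrightarrow> simple_function M s"
  by (erule Bochner_Integration.simple_bochner_integrable.cases)

text \<open>The triangle inequality through \<open>f\<close> compares any two approximants.
  Uniqueness, the Cauchy property and the norm bound of the integral all follow from this one
  estimate.\<close>

lemma simple_bochner_integral_diff_le:
  assumes "complete_measure M" and f: "strongly_measurable M f"
    and s: "Bochner_Integration.simple_bochner_integrable M s"
    and t: "Bochner_Integration.simple_bochner_integrable M t"
  shows "ennreal (norm (Bochner_Integration.simple_bochner_integral M s - Bochner_Integration.simple_bochner_integral M t))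
     \<le> (\<integral>\<^sup>+ x. ennreal (norm (f x - s x)) \<partial>M) + (\<integral>\<^sup>+ x. ennreal (norm (f x - t x)) \<partial>M)"
    (is "ennreal (norm (?s - ?t)) \<le> ?S + ?T")
proof -
  have sf: "simple_function M s" "simple_function M t"
    using s t by (auto intro: simple_bochner_integrable_simple_function)
  have [measurable]: "(\<lambda>x. norm (f x - s x)) \<in> borel_measurable M"
     "(\<lambda>x. norm (f x - t x)) \<in> borel_measurable M"
    by (rule strongly_measurable_norm_diff[OF assms(1) f sf(1)],
        rule strongly_measurable_norm_diff[OF assms(1) f sf(2)])
  have "ennreal (norm (?s - ?t)) = norm (Bochner_Integration.simple_bochner_integral M (\<lambda>x. s x - t x))"
    using s t by (subst simple_bochner_integral_diff) auto
  also have "\<dots> \<le> Bochner_Integration.simple_bochner_integral M (\<lambda>x. norm (s x - t x))"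
    using simple_bochner_integrable_compose2[of "(-)" M "s" "t"] s t
    by (auto intro!: simple_bochner_integral_norm_bound)
  also have "\<dots> = (\<integral>\<^sup>+x. norm (s x - t x) \<partial>M)"
    using simple_bochner_integrable_compose2[of "\<lambda>x y. norm (x - y)" M "s" "t"] s t
    by (auto intro!: simple_bochner_integral_eq_nn_integral)
  also have "\<dots> \<le> (\<integral>\<^sup>+x. ennreal (norm (f x - s x)) + ennreal (norm (f x - t x)) \<partial>M)"
  proof (rule nn_integral_mono)
    fix x
    have "norm (s x - t x) \<le> norm (f x - s x) + norm (f x - t x)"
      by (metis dual_order.refl norm_diff_triangle_le norm_minus_commute)
    then show "ennreal (norm (s x - t x)) \<le> ennreal (norm (f x - s x)) + ennreal (norm (f x - t x))"
      by (simp flip: ennreal_plus)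
  qed
  also have "\<dots> = ?S + ?T"
    by (rule nn_integral_add) auto
  finally show ?thesis .
qed

lemma has_banach_integralE:
  assumes "has_banach_integral M f z"
  obtains s where "\<And>i::nat. Bochner_Integration.simple_bochner_integrable M (s i)"
    "(\<lambda>i. \<integral>\<^sup>+x. ennreal (norm (f x - s i x)) \<partial>M) \<longlonglongrightarrow> 0"
    "(\<lambda>i. Bochner_Integration.simple_bochner_integral M (s i)) \<longlonglongrightarrow> z"
    "strongly_measurable M f"
  using assms unfolding has_banach_integral_def by blast

lemma has_banach_integralI:
  assumes "strongly_measurable M f"
    and "\<And>i::nat. Bochner_Integration.simple_bochner_integrable M (s i)"
    and "(\<lambda>i. \<integral>\<^sup>+x. ennreal (norm (f x - s i x)) \<partial>M) \<longlonglongrightarrow> 0"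
    and "(\<lambda>i. Bochner_Integration.simple_bochner_integral M (s i)) \<longlonglongrightarrow> z"
  shows "has_banach_integral M f z"
  using assms unfolding has_banach_integral_def by blast

text \<open>This makes the definite description in \<open>banach_integral\<close>
  meaningful.\<close>

lemma has_banach_integral_unique:
  assumes "complete_measure M" and "has_banach_integral M f y" and "has_banach_integral M f z"
  shows "y = z"
proof -
  let ?I = "Bochner_Integration.simple_bochner_integral M"
  obtain s where s: "\<And>i::nat. Bochner_Integration.simple_bochner_integrable M (s i)"
      "(\<lambda>i. \<integral>\<^sup>+x. ennreal (norm (f x - s i x)) \<partial>M) \<longlonglongrightarrow> 0" "(\<lambda>i. ?I (s i)) \<longlonglongrightarrow> y"
      and f: "strongly_measurable M f"
    using assms(2) by (rule has_banach_integralE) (rule that)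
  obtain t where t: "\<And>i::nat. Bochner_Integration.simple_bochner_integrable M (t i)"
      "(\<lambda>i. \<integral>\<^sup>+x. ennreal (norm (f x - t i x)) \<partial>M) \<longlonglongrightarrow> 0" "(\<lambda>i. ?I (t i)) \<longlonglongrightarrow> z"
    using assms(3) by (rule has_banach_integralE) (rule that)
  have "(\<lambda>i. ennreal (norm (?I (s i) - ?I (t i)))) \<longlonglongrightarrow> 0"
  proof (rule tendsto_sandwich[OF _ _ tendsto_const])
    show "eventually (\<lambda>i. ennreal (norm (?I (s i) - ?I (t i))) \<le>
        (\<integral>\<^sup>+x. ennreal (norm (f x - s i x)) \<partial>M) + (\<integral>\<^sup>+x. ennreal (norm (f x - t i x)) \<partial>M)) sequentially"
      by (intro always_eventually allI simple_bochner_integral_diff_le[OF assms(1) f] s(1) t(1))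
    show "(\<lambda>i. (\<integral>\<^sup>+x. ennreal (norm (f x - s i x)) \<partial>M) + (\<integral>\<^sup>+x. ennreal (norm (f x - t i x)) \<partial>M)) \<longlonglongrightarrow> 0"
      using tendsto_add[OF s(2) t(2)] by simp
  qed auto
  then have "(\<lambda>i. norm (?I (s i) - ?I (t i))) \<longlonglongrightarrow> 0"
    by (simp flip: ennreal_0)
  moreover have "(\<lambda>i. norm (?I (s i) - ?I (t i))) \<longlonglongrightarrow> norm (y - z)"
    using s(3) t(3) by (intro tendsto_intros)
  ultimately have "norm (y - z) = 0" by (rule LIMSEQ_unique[rotated])
  then show ?thesis by simp
qed

lemma banach_integral_eq:
  assumes "complete_measure M" and "has_banach_integral M f z"
  shows "banach_integral M f = z"
  unfolding banach_integral_def
  using assms(2) has_banach_integral_unique[OF assms(1)] by blast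

lemma has_banach_integral_cong_AE:
  assumes "has_banach_integral M f z" and ae: "AE x in M. f x = g x"
  shows "has_banach_integral M g z"
proof -
  have "(\<integral>\<^sup>+x. ennreal (norm (f x - s x)) \<partial>M) = (\<integral>\<^sup>+x. ennreal (norm (g x - s x)) \<partial>M)" for s
    using ae by (intro nn_integral_cong_AE) auto
  then show ?thesis
    using assms strongly_measurable_cong_AE[OF _ ae] by (simp add: has_banach_integral_def)
qed

lemma has_banach_integral_exists:
  fixes f :: "'s \<Rightarrow> 'e::banach"
  assumes "complete_measure M" and f: "strongly_measurable M f"
    and int: "integrable M (\<lambda>x. norm (f x))"
  obtains z where "has_banach_integral M f z"
proof -
  let ?I = "Bochner_Integration.simple_bochner_integral M"
  obtain s where s: "\<And>i::nat. simple_function M (s i)" "\<And>i x. norm (s i x) \<le> 2 * norm (f x)"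
    "AE x in M. (\<lambda>i. s i x) \<longlonglongrightarrow> f x"
    by (rule strongly_measurable_dominated[OF assms(1) f]) (rule that)
  have fin: "(\<integral>\<^sup>+x. ennreal (norm (f x)) \<partial>M) < \<infinity>"
    using int by (simp add: integrable_iff_bounded)
  have [measurable]: "(\<lambda>x. norm (f x)) \<in> borel_measurable M" "(\<lambda>x. norm (f x - s i x)) \<in> borel_measurable M"
    for i
    by (rule strongly_measurable_norm[OF assms(1) f], rule strongly_measurable_norm_diff[OF assms(1) f s(1)])
  have sb: "Bochner_Integration.simple_bochner_integrable M (s i)" for i
  proof (rule simple_bochner_integrableI_bounded[OF s(1)])
    have "(\<integral>\<^sup>+x. ennreal (norm (s i x)) \<partial>M) \<le> (\<integral>\<^sup>+x. 2 * ennreal (norm (f x)) \<partial>M)"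
      using s(2) by (intro nn_integral_mono) (metis ennreal_leI ennreal_mult' ennreal_numeral zero_le_numeral)
    also have "\<dots> = 2 * (\<integral>\<^sup>+x. ennreal (norm (f x)) \<partial>M)" by (rule nn_integral_cmult) measurable
    also have "\<dots> < \<infinity>" using fin by (simp add: ennreal_mult_less_top)
    finally show "(\<integral>\<^sup>+x. ennreal (norm (s i x)) \<partial>M) < \<infinity>" .
  qed
  \<comment> \<open>The approximants are bounded by \<open>2 * norm (f x)\<close>, so the error is
    at most three times \<open>norm (f x)\<close>.\<close>
  have lim: "(\<lambda>i. \<integral>\<^sup>+x. ennreal (norm (f x - s i x)) \<partial>M) \<longlonglongrightarrow> (\<integral>\<^sup>+x. 0 \<partial>M)"
  proof (rule nn_integral_dominated_convergence[where w="\<lambda>x. 3 * ennreal (norm (f x))"])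
    show "(\<integral>\<^sup>+ x. 3 * ennreal (norm (f x)) \<partial>M) < \<infinity>"
      using fin by (subst nn_integral_cmult) (auto simp: ennreal_mult_less_top)
    show "AE x in M. ennreal (norm (f x - s i x)) \<le> 3 * ennreal (norm (f x))" for i
    proof (rule AE_I2)
      fix x
      have "norm (f x - s i x) \<le> 3 * norm (f x)"
        using norm_triangle_ineq4[of "f x" "s i x"] s(2)[of i x] by simp
      then show "ennreal (norm (f x - s i x)) \<le> 3 * ennreal (norm (f x))"
        by (metis ennreal_leI ennreal_mult' ennreal_numeral zero_le_numeral)
    qed
    show "AE x in M. (\<lambda>i. ennreal (norm (f x - s i x))) \<longlonglongrightarrow> 0"
      using s(3)
    proof eventually_elim
      case (elim x)
      have "(\<lambda>i. norm (f x - s i x)) \<longlonglongrightarrow> norm (f x - f x)"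
        using elim by (intro tendsto_intros)
      then show ?case by (simp flip: ennreal_0)
    qed
  qed auto
  have "Cauchy (\<lambda>i. ?I (s i))"
  proof (rule metric_CauchyI)
    fix e :: real assume "e > 0"
    then have "eventually (\<lambda>i. (\<integral>\<^sup>+x. ennreal (norm (f x - s i x)) \<partial>M) < ennreal (e/2)) sequentially"
      using lim by (intro order_tendstoD) auto
    then obtain N where N: "\<And>i. i \<ge> N \<Longrightarrow> (\<integral>\<^sup>+x. ennreal (norm (f x - s i x)) \<partial>M) < ennreal (e/2)"
      by (auto simp: eventually_sequentially)
    have "dist (?I (s m)) (?I (s n)) < e" if "m \<ge> N" "n \<ge> N" for m n
    proof -
      have "ennreal (norm (?I (s m) - ?I (s n))) < ennreal (e/2) + ennreal (e/2)"
        by (rule le_less_trans[OF simple_bochner_integral_diff_le[OF assms(1) f sb sb]])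
          (intro add_strict_mono N that)
      also have "\<dots> = ennreal e" using \<open>e > 0\<close> by (simp flip: ennreal_plus)
      finally show ?thesis by (simp add: dist_norm ennreal_less_iff)
    qed
    then show "\<exists>N. \<forall>m\<ge>N. \<forall>n\<ge>N. dist (?I (s m)) (?I (s n)) < e" by blast
  qed
  then obtain z where "(\<lambda>i. ?I (s i)) \<longlonglongrightarrow> z" using Cauchy_convergent_iff convergent_def by blast
  with sb lim f show ?thesis by (intro that[of z]) (auto simp: has_banach_integral_def)
qed

lemma has_banach_integral_banach_integral:
  fixes f :: "'s \<Rightarrow> 'e::banach"
  assumes "complete_measure M" and "strongly_measurable M f" and "integrable M (\<lambda>x. norm (f x))"
  shows "has_banach_integral M f (banach_integral M f)"
  using has_banach_integral_exists[OF assms] banach_integral_eq[OF assms(1)] by metis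

lemma has_banach_integral_zero: "has_banach_integral M (\<lambda>x. 0) 0"
proof (rule has_banach_integralI[where s="\<lambda>i x. 0"])
  have "Bochner_Integration.simple_bochner_integral M (\<lambda>x. 0 :: 'b) = 0"
    by (auto simp: Bochner_Integration.simple_bochner_integral_def intro!: sum.neutral)
  then show "(\<lambda>i. Bochner_Integration.simple_bochner_integral M (\<lambda>x. 0 :: 'b)) \<longlonglongrightarrow> 0" by simp
qed (auto intro: strongly_measurable_simple simple_bochner_integrableI_bounded)

lemma has_banach_integral_add:
  assumes "complete_measure M" and "has_banach_integral M f y" and "has_banach_integral M g z"
  shows "has_banach_integral M (\<lambda>x. f x + g x) (y + z)"
proof -
  let ?I = "Bochner_Integration.simple_bochner_integral M"
  obtain s where s: "\<And>i::nat. Bochner_Integration.simple_bochner_integrable M (s i)"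
      "(\<lambda>i. \<integral>\<^sup>+x. ennreal (norm (f x - s i x)) \<partial>M) \<longlonglongrightarrow> 0" "(\<lambda>i. ?I (s i)) \<longlonglongrightarrow> y"
      and f: "strongly_measurable M f"
    using assms(2) by (rule has_banach_integralE) (rule that)
  obtain t where t: "\<And>i::nat. Bochner_Integration.simple_bochner_integrable M (t i)"
      "(\<lambda>i. \<integral>\<^sup>+x. ennreal (norm (g x - t i x)) \<partial>M) \<longlonglongrightarrow> 0" "(\<lambda>i. ?I (t i)) \<longlonglongrightarrow> z"
    and g: "strongly_measurable M g"
    using assms(3) by (rule has_banach_integralE) (rule that)
  have sf: "simple_function M (s i)" "simple_function M (t i)" for i
    by (rule simple_bochner_integrable_simple_function[OF s(1)], rule simple_bochner_integrable_simple_function[OF t(1)])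
  have [measurable]: "(\<lambda>x. norm (f x - s i x)) \<in> borel_measurable M"
     "(\<lambda>x. norm (g x - t i x)) \<in> borel_measurable M" for i
    by (rule strongly_measurable_norm_diff[OF assms(1) f sf(1)],
        rule strongly_measurable_norm_diff[OF assms(1) g sf(2)])
  have "(\<lambda>i. \<integral>\<^sup>+x. ennreal (norm (f x + g x - (s i x + t i x))) \<partial>M) \<longlonglongrightarrow> 0"
  proof (rule tendsto_sandwich[OF _ _ tendsto_const])
    have "(\<integral>\<^sup>+x. ennreal (norm (f x + g x - (s i x + t i x))) \<partial>M) \<le>
        (\<integral>\<^sup>+x. ennreal (norm (f x - s i x)) + ennreal (norm (g x - t i x)) \<partial>M)" for i
    proof (intro nn_integral_mono)
      fix x show "ennreal (norm (f x + g x - (s i x + t i x))) \<le> ennreal (norm (f x - s i x)) + ennreal (norm (g x - t i x))"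
        using norm_triangle_ineq[of "f x - s i x" "g x - t i x"]
        by (simp add: algebra_simps flip: ennreal_plus)
    qed
    then show "eventually (\<lambda>i. (\<integral>\<^sup>+x. ennreal (norm (f x + g x - (s i x + t i x))) \<partial>M) \<le>
        (\<integral>\<^sup>+x. ennreal (norm (f x - s i x)) \<partial>M) + (\<integral>\<^sup>+x. ennreal (norm (g x - t i x)) \<partial>M)) sequentially"
      by (simp add: nn_integral_add)
    show "(\<lambda>i. (\<integral>\<^sup>+x. ennreal (norm (f x - s i x)) \<partial>M) + (\<integral>\<^sup>+x. ennreal (norm (g x - t i x)) \<partial>M)) \<longlonglongrightarrow> 0"
      using tendsto_add[OF s(2) t(2)] by simp
  qed auto
  moreover have "(\<lambda>i. ?I (\<lambda>x. s i x + t i x)) \<longlonglongrightarrow> y + z"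
    using tendsto_add[OF s(3) t(3)] s(1) t(1) by (simp add: simple_bochner_integral_add)
  moreover have "Bochner_Integration.simple_bochner_integrable M (\<lambda>x. s i x + t i x)" for i
    using s(1) t(1) by (intro simple_bochner_integrable_compose2[where p="(+)"]) auto
  ultimately show ?thesis
    by (intro has_banach_integralI[where s="\<lambda>i x. s i x + t i x"] strongly_measurable_add[OF f g])
qed

lemma has_banach_integral_bounded_linear:
  assumes "complete_measure M" and L: "bounded_linear L" and "has_banach_integral M f z"
  shows "has_banach_integral M (\<lambda>x. L (f x)) (L z)"
proof -
  let ?I = "Bochner_Integration.simple_bochner_integral M"
  interpret L: bounded_linear L by fact
  obtain s where s: "\<And>i::nat. Bochner_Integration.simple_bochner_integrable M (s i)"
      "(\<lambda>i. \<integral>\<^sup>+x. ennreal (norm (f x - s i x)) \<partial>M) \<longlonglongrightarrow> 0" "(\<lambda>i. ?I (s i)) \<longlonglongrightarrow> z"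
    and f: "strongly_measurable M f"
    using assms(3) by (rule has_banach_integralE) (rule that)
  have sf: "simple_function M (s i)" for i
    by (rule simple_bochner_integrable_simple_function[OF s(1)])
  have [measurable]: "(\<lambda>x. norm (f x - s i x)) \<in> borel_measurable M" for i
    by (rule strongly_measurable_norm_diff[OF assms(1) f sf])
  obtain K where K: "K \<ge> 0" "\<And>x. norm (L x) \<le> norm x * K" using L.nonneg_bounded by blast
  have "(\<lambda>i. \<integral>\<^sup>+x. ennreal (norm (L (f x) - L (s i x))) \<partial>M) \<longlonglongrightarrow> 0"
  proof (rule tendsto_sandwich[OF _ _ tendsto_const])
    have "(\<integral>\<^sup>+x. ennreal (norm (L (f x) - L (s i x))) \<partial>M) \<le>
        (\<integral>\<^sup>+x. ennreal K * ennreal (norm (f x - s i x)) \<partial>M)" for i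
      using K
      by (intro nn_integral_mono) (metis L.diff mult.commute ennreal_leI ennreal_mult norm_ge_zero)
    then show "eventually (\<lambda>i. (\<integral>\<^sup>+x. ennreal (norm (L (f x) - L (s i x))) \<partial>M) \<le>
        ennreal K * (\<integral>\<^sup>+x. ennreal (norm (f x - s i x)) \<partial>M)) sequentially"
      by (simp add: nn_integral_cmult)
    show "(\<lambda>i. ennreal K * (\<integral>\<^sup>+x. ennreal (norm (f x - s i x)) \<partial>M)) \<longlonglongrightarrow> 0"
      using ennreal_tendsto_cmult[OF _ s(2), of "ennreal K"] by simp
  qed auto
  moreover have "(\<lambda>i. ?I (\<lambda>x. L (s i x))) \<longlonglongrightarrow> L z"
    using L.tendsto[OF s(3)] s(1) by (simp add: simple_bochner_integral_linear L.linear_axioms)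
  moreover have "Bochner_Integration.simple_bochner_integrable M (\<lambda>x. L (s i x))" for i
    using s(1) by (intro simple_bochner_integrable_compose2[where p="\<lambda>x y. L x"]) (auto simp: L.zero)
  ultimately show ?thesis
    by (intro has_banach_integralI[where s="\<lambda>i x. L (s i x)"] strongly_measurable_bounded_linear[OF L f])
qed

lemma has_banach_integral_norm_le:
  assumes "complete_measure M" and "has_banach_integral M f z"
    and int: "integrable M (\<lambda>x. norm (f x))"
  shows "norm z \<le> (\<integral>x. norm (f x) \<partial>M)"
proof -
  let ?I = "Bochner_Integration.simple_bochner_integral M"
  obtain s where s: "\<And>i::nat. Bochner_Integration.simple_bochner_integrable M (s i)"
      "(\<lambda>i. \<integral>\<^sup>+x. ennreal (norm (f x - s i x)) \<partial>M) \<longlonglongrightarrow> 0" "(\<lambda>i. ?I (s i)) \<longlonglongrightarrow> z"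
    and f: "strongly_measurable M f"
    using assms(2) by (rule has_banach_integralE) (rule that)
  \<comment> \<open>Comparing the approximants with the zero function turns the difference estimate
    into a bound on their integrals.\<close>
  have z: "Bochner_Integration.simple_bochner_integrable M (\<lambda>x. 0::'b)"
    by (intro simple_bochner_integrableI_bounded) auto
  have "ennreal (norm z) \<le> (\<integral>\<^sup>+x. ennreal (norm (f x)) \<partial>M)"
  proof (rule LIMSEQ_le)
    show "(\<lambda>i. ennreal (norm (?I (s i)))) \<longlonglongrightarrow> norm z"
      using s(3) by (auto simp: tendsto_ennreal_iff intro: tendsto_intros)
    have "?I (\<lambda>x. 0::'b) = 0" by (auto simp: Bochner_Integration.simple_bochner_integral_def intro!: sum.neutral)
    then show "\<exists>N. \<forall>n\<ge>N. ennreal (norm (?I (s n))) \<le> (\<integral>\<^sup>+x. norm (f x - s n x) \<partial>M) + (\<integral>\<^sup>+x. norm (f x) \<partial>M)"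
      using simple_bochner_integral_diff_le[OF assms(1) f s(1) z] by simp
    show "(\<lambda>n. (\<integral>\<^sup>+x. norm (f x - s n x) \<partial>M) + (\<integral>\<^sup>+x. norm (f x) \<partial>M)) \<longlonglongrightarrow> (\<integral>\<^sup>+x. ennreal (norm (f x)) \<partial>M)"
      using tendsto_add[OF s(2) tendsto_const] by simp
  qed
  also have "\<dots> = ennreal (\<integral>x. norm (f x) \<partial>M)"
    using int by (intro nn_integral_eq_integral) auto
  finally show ?thesis by (simp add: ennreal_le_iff)
qed

text \<open>Puts integrals over different intervals on one measure space, which is how the cocycle
  identity splits and rejoins them.\<close>

lemma has_banach_integral_restrict_space:
  fixes f :: "'s \<Rightarrow> 'e::real_normed_vector"
  assumes "has_banach_integral (restrict_space M S) f z" and S: "S \<in> sets M"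
  shows "has_banach_integral M (\<lambda>x. indicator S x *\<^sub>R f x) z"
proof -
  have S': "S \<inter> space M \<in> sets M" using S by auto
  obtain s where s: "\<And>i::nat. Bochner_Integration.simple_bochner_integrable (restrict_space M S) (s i)"
      "(\<lambda>i. \<integral>\<^sup>+x. ennreal (norm (f x - s i x)) \<partial>restrict_space M S) \<longlonglongrightarrow> 0"
      "(\<lambda>i. Bochner_Integration.simple_bochner_integral (restrict_space M S) (s i)) \<longlonglongrightarrow> z"
    and f: "strongly_measurable (restrict_space M S) f"
    using assms(1) by (rule has_banach_integralE) (rule that)
  have "ennreal (norm (f x - s i x)) * indicator S x
      = ennreal (norm (indicator S x *\<^sub>R f x - indicator S x *\<^sub>R s i x))" for i x
    by (auto simp: indicator_def)
  then have "(\<lambda>i. \<integral>\<^sup>+x. ennreal (norm (indicator S x *\<^sub>R f x - indicator S x *\<^sub>R s i x)) \<partial>M) \<longlonglongrightarrow> 0"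
    using s(2) by (simp add: nn_integral_restrict_space[OF S'])
  moreover have "strongly_measurable M (\<lambda>x. indicator S x *\<^sub>R f x)"
    using f strongly_measurable_restrict_space[OF S] by blast
  moreover have "Bochner_Integration.simple_bochner_integrable M (\<lambda>x. indicator S x *\<^sub>R s i x)" for i
    using s(1) simple_bochner_integrable_restrict_space[OF S'] by blast
  moreover have "(\<lambda>i. Bochner_Integration.simple_bochner_integral M (\<lambda>x. indicator S x *\<^sub>R s i x)) \<longlonglongrightarrow> z"
    using s(3) unfolding simple_bochner_integral_restrict_space[OF S' s(1)] .
  ultimately show ?thesis
    by (intro has_banach_integralI[where s="\<lambda>i x. indicator S x *\<^sub>R s i x"])
qed

lemma has_banach_integral_comp:
  assumes g: "g \<in> measurable M N" and d: "distr M N g = N" and surj: "g ` space M = space N"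
    and "has_banach_integral N f z" and "complete_measure N"
  shows "has_banach_integral M (\<lambda>x. f (g x)) z"
proof -
  obtain s where s: "\<And>i::nat. Bochner_Integration.simple_bochner_integrable N (s i)"
      "(\<lambda>i. \<integral>\<^sup>+x. ennreal (norm (f x - s i x)) \<partial>N) \<longlonglongrightarrow> 0"
      "(\<lambda>i. Bochner_Integration.simple_bochner_integral N (s i)) \<longlonglongrightarrow> z"
    and f: "strongly_measurable N f"
    using assms(4) by (rule has_banach_integralE) (rule that)
  have sf: "simple_function N (s i)" for i
    by (rule simple_bochner_integrable_simple_function[OF s(1)])
  have pre: "emeasure M {x \<in> space M. P (g x)} = emeasure N {x \<in> space N. P x}"
    if "{x \<in> space N. P x} \<in> sets N" for P
  proof -
    have "emeasure (distr M N g) {x \<in> space N. P x} = emeasure M (g -` {x \<in> space N. P x} \<inter> space M)"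
      using that by (intro emeasure_distr g)
    also have "g -` {x \<in> space N. P x} \<inter> space M = {x \<in> space M. P (g x)}"
      using measurable_space[OF g] by auto
    finally show ?thesis using d by simp
  qed
  \<comment> \<open>A simple function is measurable into the discrete space, so every set defined
    through its values is measurable.\<close>
  have lev: "{x \<in> space N. Q (s i x)} \<in> sets N" for i Q
    using measurable_sets[OF measurable_simple_function[OF sf], of "{y. Q y}"]
    by (simp add: vimage_def Int_def conj_commute)
  have sb: "Bochner_Integration.simple_bochner_integrable M (\<lambda>x. s i (g x))" for i
  proof
    show "simple_function M (\<lambda>x. s i (g x))" by (rule simple_function_comp[OF g sf])
    show "emeasure M {x \<in> space M. s i (g x) \<noteq> 0} \<noteq> \<infinity>"
      using s(1)[of i] pre[OF lev[of "\<lambda>y. y \<noteq> 0"]]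
      by (auto elim: Bochner_Integration.simple_bochner_integrable.cases)
  qed
  have "Bochner_Integration.simple_bochner_integral M (\<lambda>x. s i (g x)) = Bochner_Integration.simple_bochner_integral N (s i)" for i
  proof -
    \<comment> \<open>The integral of a simple function sums over the values attained on the space;
      surjectivity of \<open>g\<close> makes both sums run over the same values.\<close>
    have im: "(\<lambda>x. s i (g x)) ` space M = s i ` space N"
      using surj by (metis image_image)
    show ?thesis
      unfolding Bochner_Integration.simple_bochner_integral_def measure_def im
      by (intro sum.cong refl arg_cong2[where f="scaleR"] arg_cong[where f=enn2real]
          pre[where P="\<lambda>x. s i x = y" for y] lev)
  qed
  moreover have "(\<integral>\<^sup>+x. ennreal (norm (f (g x) - s i (g x))) \<partial>M) = (\<integral>\<^sup>+x. ennreal (norm (f x - s i x)) \<partial>N)" for i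
  proof -
    have "(\<lambda>x. norm (f x - s i x)) \<in> borel_measurable N"
      by (rule strongly_measurable_norm_diff[OF assms(5) f sf])
    then have "(\<integral>\<^sup>+x. ennreal (norm (f x - s i x)) \<partial>distr M N g) = (\<integral>\<^sup>+x. ennreal (norm (f (g x) - s i (g x))) \<partial>M)"
      by (intro nn_integral_distr g) simp
    then show ?thesis using d by simp
  qed
  ultimately show ?thesis
    using s(2,3) sb
    by (intro has_banach_integralI[where s="\<lambda>i x. s i (g x)"] strongly_measurable_comp[OF g d f]) simp_all
qed

lemma translation_lebesgue:
  fixes c :: real
  shows "(\<lambda>x. x + c) \<in> measurable lebesgue lebesgue" "distr lebesgue lebesgue (\<lambda>x. x + c) = lebesgue"
proof -
  have *: "(\<lambda>x. x + c) -` S = (\<lambda>x. - c + x) ` S" for S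
    by (auto simp: image_iff algebra_simps intro!: bexI[where x="_ + c"])
  show m: "(\<lambda>x. x + c) \<in> measurable lebesgue lebesgue"
    by (rule measurableI) (simp_all add: * lebesgue_sets_translation del: add_uminus_conv_diff uminus_add_conv_diff)
  show "distr lebesgue lebesgue (\<lambda>x. x + c) = lebesgue"
  proof (rule measure_eqI)
    fix S assume "S \<in> sets (distr lebesgue lebesgue (\<lambda>x. x + c))"
    then have "S \<in> sets lebesgue" by simp
    then show "emeasure (distr lebesgue lebesgue (\<lambda>x. x + c)) S = emeasure lebesgue S"
      using m emeasure_lebesgue_affine[of 1 "- c" S]
      by (subst emeasure_distr) (simp_all add: * add.commute)
  qed simp
qed

section \<open>Extension of operators to the extrapolation space\<close>

lemma continuous_eq_on_dense:
  fixes f g :: "'c::topological_space \<Rightarrow> 'd::t2_space"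
  assumes "continuous_on UNIV f" and "continuous_on UNIV g" and "closure S = UNIV"
    and "\<And>x. x \<in> S \<Longrightarrow> f x = g x"
  shows "f z = g z"
proof -
  have "closed {x. f x = g x}" using assms(1,2) by (rule closed_Collect_eq)
  moreover have "S \<subseteq> {x. f x = g x}" using assms(4) by auto
  ultimately have "closure S \<subseteq> {x. f x = g x}" by (rule closure_minimal[rotated])
  with assms(3) show ?thesis by auto
qed

text \<open>The bound by \<open>norm (j x)\<close> shows that \<open>L\<close> maps
  \<open>j\<close>-Cauchy sequences to Cauchy sequences and that the limit does not depend on the
  sequence chosen. No continuity of \<open>j\<close> is involved, only its linearity and dense
  range.\<close>

lemma dense_extension:
  fixes j :: "'a::real_normed_vector \<Rightarrow> 'c::real_normed_vector" and L :: "'a \<Rightarrow> 'd::banach"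
  assumes j: "linear j" and L: "linear L" and dense: "closure (range j) = UNIV"
    and K: "\<And>x. norm (L x) \<le> K * norm (j x)"
  obtains E where "bounded_linear E" "\<And>x. E (j x) = L x" "\<And>z. norm (E z) \<le> K * norm z"
proof -
  interpret j: linear j by fact
  interpret L: linear L by fact
  have "\<exists>x. (\<lambda>n. j (x n)) \<longlonglongrightarrow> z" for z
  proof -
    have "z \<in> closure (range j)" using dense by simp
    then obtain y where y: "\<And>n. y n \<in> range j" "y \<longlonglongrightarrow> z" unfolding closure_sequential by blast
    then have "y = (\<lambda>n. j (inv j (y n)))" by (auto simp: f_inv_into_f)
    with y(2) show ?thesis by metis
  qed
  then obtain X where X: "\<And>z. (\<lambda>n. j (X z n)) \<longlonglongrightarrow> z" by metis
  have "convergent (\<lambda>n. L (X z n))" for z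
  proof (rule Cauchy_convergent, rule metric_CauchyI)
    fix e :: real assume "e > 0"
    \<comment> \<open>\<open>K\<close> may be zero or negative; \<open>\<bar>K\<bar> + 1\<close> is
      a positive replacement.\<close>
    then have e': "e / (\<bar>K\<bar> + 1) > 0" by (simp add: add_nonneg_pos)
    obtain N where N: "\<And>m n. m \<ge> N \<Longrightarrow> n \<ge> N \<Longrightarrow> dist (j (X z m)) (j (X z n)) < e / (\<bar>K\<bar> + 1)"
      using metric_CauchyD[OF LIMSEQ_imp_Cauchy[OF X] e'] by blast
    have "dist (L (X z m)) (L (X z n)) < e" if "m \<ge> N" "n \<ge> N" for m n
    proof -
      have "dist (L (X z m)) (L (X z n)) \<le> K * norm (j (X z m - X z n))"
        unfolding dist_norm L.diff[symmetric] by (rule K)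
      also have "\<dots> \<le> (\<bar>K\<bar> + 1) * norm (j (X z m - X z n))" by (intro mult_right_mono) auto
      also have "\<dots> < e" using N[OF that] by (simp add: dist_norm j.diff field_simps add_nonneg_pos)
      finally show ?thesis .
    qed
    then show "\<exists>N. \<forall>m\<ge>N. \<forall>n\<ge>N. dist (L (X z m)) (L (X z n)) < e" by blast
  qed
  then obtain E where E: "\<And>z. (\<lambda>n. L (X z n)) \<longlonglongrightarrow> E z" unfolding convergent_def by metis
  \<comment> \<open>Independence of the approximating sequence; additivity and homogeneity of
    \<open>E\<close> are read off by choosing convenient sequences.\<close>
  have key: "(\<lambda>n. L (y n)) \<longlonglongrightarrow> E z" if "(\<lambda>n. j (y n)) \<longlonglongrightarrow> z" for y z
  proof -
    have "(\<lambda>n. j (y n) - j (X z n)) \<longlonglongrightarrow> z - z" using that X by (intro tendsto_intros)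
    then have "(\<lambda>n. K * norm (j (y n) - j (X z n))) \<longlonglongrightarrow> 0"
      by (intro tendsto_mult_right_zero tendsto_norm_zero) simp
    then have "(\<lambda>n. L (y n) - L (X z n)) \<longlonglongrightarrow> 0"
      by (rule Lim_null_comparison[rotated]) (use K in \<open>simp add: L.diff[symmetric] j.diff[symmetric]\<close>)
    from tendsto_add[OF this E[of z]] show ?thesis by simp
  qed
  have bd: "norm (E z) \<le> K * norm z" for z
  proof (rule LIMSEQ_le)
    show "(\<lambda>n. norm (L (X z n))) \<longlonglongrightarrow> norm (E z)" using E by (rule tendsto_norm)
    show "(\<lambda>n. K * norm (j (X z n))) \<longlonglongrightarrow> K * norm z" using X by (intro tendsto_intros)
    show "\<exists>N. \<forall>n\<ge>N. norm (L (X z n)) \<le> K * norm (j (X z n))" using K by blast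
  qed
  show ?thesis
  proof
    show "E (j x) = L x" for x
      using LIMSEQ_unique[OF key[of "\<lambda>_. x"] tendsto_const] by simp
    show "norm (E z) \<le> K * norm z" for z by (rule bd)
    show "bounded_linear E"
    proof (rule bounded_linear_intro[where K=K])
      show "E (y + z) = E y + E z" for y z
      proof -
        have "(\<lambda>n. j (X y n + X z n)) \<longlonglongrightarrow> y + z" unfolding j.add using X by (intro tendsto_intros)
        from key[OF this] tendsto_add[OF E E] show ?thesis
          unfolding L.add by (rule LIMSEQ_unique)
      qed
      show "E (c *\<^sub>R z) = c *\<^sub>R E z" for c z
      proof -
        have "(\<lambda>n. j (c *\<^sub>R X z n)) \<longlonglongrightarrow> c *\<^sub>R z" unfolding j.scale using X by (intro tendsto_intros)
        from key[OF this] tendsto_scaleR[OF tendsto_const E] show ?thesis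
          unfolding L.scale by (rule LIMSEQ_unique)
      qed
      show "norm (E z) \<le> norm z * K" for z using bd[of z] by (simp add: mult.commute)
    qed
  qed
qed

section \<open>The extrapolated semigroup\<close>

locale extrapolated_system =
  fixes T :: "real \<Rightarrow> 'a::banach \<Rightarrow>\<^sub>L 'a" and D :: "'a set" and A :: "'a \<Rightarrow> 'a" and a :: real
    and j :: "'a \<Rightarrow> 'c::banach"
  assumes semigroup: "C0_semigroup T" and generator: "is_generator T D A"
    and resolvent_set: "a \<in> resolvent_set D A" and extrapolation: "extrapolation_space D A a j"
begin

abbreviation "R \<equiv> resolvent D A a"

lemma T_0 [simp]: "blinfun_apply (T 0) x = x"
  using semigroup by (simp add: C0_semigroup_def)

lemma T_add: "s \<ge> 0 \<Longrightarrow> t \<ge> 0 \<Longrightarrow> T (s + t) x = T s (T t x)"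
  using semigroup by (simp add: C0_semigroup_def)

lemma bij: "bij_betw (\<lambda>x. a *\<^sub>R x - A x) D UNIV"
  using resolvent_set by (simp add: resolvent_set_def)

lemma bounded_linear_R: "bounded_linear R"
  using resolvent_set by (simp add: resolvent_set_def)

lemma R_in_D: "R x \<in> D" and resolvent_equation: "a *\<^sub>R R x - A (R x) = x"
proof -
  have im: "x \<in> (\<lambda>x. a *\<^sub>R x - A x) ` D" using bij by (simp add: bij_betw_def)
  show "R x \<in> D" unfolding resolvent_def by (rule inv_into_into[OF im])
  show "a *\<^sub>R R x - A (R x) = x" unfolding resolvent_def by (rule f_inv_into_f[OF im])
qed

lemma R_unique: "y \<in> D \<Longrightarrow> a *\<^sub>R y - A y = x \<Longrightarrow> R x = y"
  using bij unfolding resolvent_def bij_betw_def by (auto intro: inv_into_f_f)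

text \<open>Applying the bounded operator \<open>T t\<close> to the difference quotients shows that
  \<open>T t\<close> preserves \<open>D\<close> and commutes with \<open>A\<close> there;
  bijectivity of \<open>a - A\<close> does the rest.\<close>

lemma R_commute: "t \<ge> 0 \<Longrightarrow> R (T t x) = T t (R x)"
proof (rule R_unique)
  assume t: "t \<ge> 0"
  define y where "y = R x"
  have y: "((\<lambda>h. (T h y - y) /\<^sub>R h) \<longlongrightarrow> A y) (at_right 0)"
    using generator R_in_D[of x] by (simp add: is_generator_def y_def)
  have "((\<lambda>h. T t ((T h y - y) /\<^sub>R h)) \<longlongrightarrow> T t (A y)) (at_right 0)"
    by (rule bounded_linear.tendsto[OF blinfun.bounded_linear_right y])
  moreover have "eventually (\<lambda>h. T t ((T h y - y) /\<^sub>R h) = (T h (T t y) - T t y) /\<^sub>R h) (at_right 0)"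
    using eventually_at_right_less[of 0]
  proof eventually_elim
    case (elim h)
    then have "T t (T h y) = T h (T t y)"
      using T_add[of t h y] T_add[of h t y] t by (simp add: add.commute)
    then show ?case by (simp add: blinfun.scaleR_right blinfun.diff_right)
  qed
  ultimately have *: "((\<lambda>h. (T h (T t y) - T t y) /\<^sub>R h) \<longlongrightarrow> T t (A y)) (at_right 0)"
    by (simp cong: tendsto_cong)
  then have D: "T t y \<in> D" using generator unfolding is_generator_def by blast
  then have "((\<lambda>h. (T h (T t y) - T t y) /\<^sub>R h) \<longlongrightarrow> A (T t y)) (at_right 0)"
    using generator by (simp add: is_generator_def)
  from tendsto_unique[OF _ this *] have "A (T t y) = T t (A y)" by simp
  then have "a *\<^sub>R T t y - A (T t y) = T t (a *\<^sub>R y - A y)"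
    by (simp add: blinfun.scaleR_right blinfun.diff_right)
  then show "a *\<^sub>R T t (R x) - A (T t (R x)) = T t x"
    using resolvent_equation[of x] by (simp add: y_def)
  show "T t (R x) \<in> D" using D by (simp add: y_def)
qed

lemma linear_j: "linear j" and norm_j: "norm (j x) = norm (R x)" and dense_j: "closure (range j) = UNIV"
  using extrapolation by (auto simp: extrapolation_space_def)

text \<open>The resolvent is injective and \<open>j\<close> inherits this through the isometry. It
  is what makes \<open>inv j\<close>, and hence \<open>X_norm\<close>, return the element of
  \<open>X\<close> itself.\<close>

lemma inj_j: "inj j"
proof (rule injI)
  fix x y assume "j x = j y"
  then have "norm (R (x - y)) = 0"
    using linear_j norm_j[of "x - y"] by (simp add: linear_diff)
  then have "R x = R y"
    using bounded_linear.linear[OF bounded_linear_R] by (simp add: linear_diff)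
  then show "x = y" by (metis resolvent_equation)
qed

lemma bounded_linear_j: "bounded_linear j"
proof -
  obtain K where "\<And>x. norm (R x) \<le> norm x * K"
    using bounded_linear.bounded[OF bounded_linear_R] by blast
  with linear_j show ?thesis
    by (intro bounded_linear_intro[where K=K]) (auto simp: norm_j linear_add linear_scale)
qed

lemma inv_j [simp]: "inv j (j x) = x"
  by (simp add: inv_f_f inj_j)

lemma X_norm_j [simp]: "X_norm j (j x) = norm x"
  by (simp add: X_norm_def)

text \<open>Commutation with the resolvent gives \<open>norm (j (T t x)) = norm (T t (R x))\<close>,
  so \<open>T t\<close> is bounded for the weaker norm too and extends by density. Existence and
  uniqueness together justify the definite description in
  \<open>extrapolated_semigroup\<close>.\<close>

lemma extrapolated_semigroup_ex1:
  assumes t: "t \<ge> 0"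
  shows "\<exists>!S. \<forall>x. blinfun_apply S (j x) = j (T t x)"
proof -
  have bl: "norm (j (T t x)) \<le> norm (T t) * norm (j x)" for x
    by (simp add: norm_j R_commute t norm_blinfun)
  have lin: "linear (\<lambda>x. j (T t x))"
    by (rule bounded_linear.linear[OF bounded_linear_compose[OF bounded_linear_j blinfun.bounded_linear_right]])
  obtain E where E: "bounded_linear E" "\<And>x. E (j x) = j (T t x)"
    by (rule dense_extension[OF linear_j lin dense_j bl]) (rule that)
  show ?thesis
  proof (rule ex1I[of _ "Blinfun E"])
    show "\<forall>x. blinfun_apply (Blinfun E) (j x) = j (T t x)"
      by (simp add: bounded_linear_Blinfun_apply E)
    fix S assume S: "\<forall>x. blinfun_apply S (j x) = j (T t x)"
    show "S = Blinfun E"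
    proof (rule blinfun_eqI)
      fix z show "S z = Blinfun E z"
      proof (rule continuous_eq_on_dense[of "blinfun_apply S" "blinfun_apply (Blinfun E)", OF _ _ dense_j])
        show "continuous_on UNIV (blinfun_apply S)" "continuous_on UNIV (blinfun_apply (Blinfun E))"
          by (intro continuous_intros)+
      qed (auto simp: S bounded_linear_Blinfun_apply E)
    qed
  qed
qed

abbreviation "TX \<equiv> extrapolated_semigroup j T"

lemma TX_j: "t \<ge> 0 \<Longrightarrow> TX t (j x) = j (T t x)"
  using theI'[OF extrapolated_semigroup_ex1, of t] unfolding extrapolated_semigroup_def by blast

lemma TX_add:
  assumes "s \<ge> 0" "t \<ge> 0"
  shows "TX (s + t) z = TX s (TX t z)"
proof (rule continuous_eq_on_dense[of "\<lambda>z. TX (s + t) z" "\<lambda>z. TX s (TX t z)", OF _ _ dense_j])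
  show "continuous_on UNIV (\<lambda>z. TX (s + t) z)" "continuous_on UNIV (\<lambda>z. TX s (TX t z))"
    by (intro continuous_intros)+
qed (use assms in \<open>auto simp: TX_j T_add\<close>)

lemma TX_0 [simp]: "blinfun_apply (TX 0) z = z"
proof (rule continuous_eq_on_dense[of "\<lambda>z. TX 0 z" "\<lambda>z. z", OF _ _ dense_j])
  show "continuous_on UNIV (\<lambda>z. TX 0 z)" "continuous_on UNIV (\<lambda>z::'c. z)"
    by (intro continuous_intros)+
qed (auto simp: TX_j)

lemma norm_TX_le:
  assumes "t \<ge> 0"
  shows "norm (TX t z) \<le> norm (T t) * norm z"
proof -
  have "closed {z. norm (TX t z) \<le> norm (T t) * norm z}"
    by (intro closed_Collect_le continuous_intros)
  moreover have "range j \<subseteq> {z. norm (TX t z) \<le> norm (T t) * norm z}"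
    using assms by (auto simp: TX_j norm_j R_commute norm_blinfun)
  ultimately have "closure (range j) \<subseteq> {z. norm (TX t z) \<le> norm (T t) * norm z}"
    by (rule closure_minimal[rotated])
  with dense_j show ?thesis by auto
qed

text \<open>
  On \<open>X\<close> the difference quotients converge to \<open>(a - A) (a - A)\<^sup>-\<^sup>1 x = x\<close>, while each of them is
  defined and bounded on the whole extrapolation space.
\<close>

lemma approximate_identity:
  obtains S :: "nat \<Rightarrow> 'c \<Rightarrow> 'a" where "\<And>n. bounded_linear (S n)" "\<And>x. (\<lambda>n. S n (j x)) \<longlonglongrightarrow> x"
proof -
  \<comment> \<open>Since \<open>norm (j x) = norm (R x)\<close>, the resolvent extends with
    constant 1 to a map from the whole extrapolation space into \<open>X\<close>.\<close>
  obtain J where J: "bounded_linear J" "\<And>x. J (j x) = R x"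
    by (rule dense_extension[OF linear_j bounded_linear.linear[OF bounded_linear_R] dense_j, of 1])
      (simp add: norm_j, rule that)
  define h where "h n = inverse (real (Suc n))" for n
  define S where "S n z = a *\<^sub>R J z - (T (h n) (J z) - J z) /\<^sub>R h n" for n z
  have h: "filterlim h (at_right 0) sequentially"
    unfolding h_def using LIMSEQ_inverse_real_of_nat
    by (auto simp: filterlim_at intro!: always_eventually)
  show ?thesis
  proof
    show "bounded_linear (S n)" for n
      unfolding S_def
      by (intro bounded_linear_sub bounded_linear_const_scaleR bounded_linear_compose[OF blinfun.bounded_linear_right] J(1))
    show "(\<lambda>n. S n (j x)) \<longlonglongrightarrow> x" for x
    proof -
      have "((\<lambda>h. (T h (R x) - R x) /\<^sub>R h) \<longlongrightarrow> A (R x)) (at_right 0)"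
        using generator R_in_D[of x] by (simp add: is_generator_def)
      from filterlim_compose[OF this h]
      have "(\<lambda>n. (T (h n) (R x) - R x) /\<^sub>R h n) \<longlonglongrightarrow> A (R x)" by simp
      then have "(\<lambda>n. S n (j x)) \<longlonglongrightarrow> a *\<^sub>R R x - A (R x)"
        unfolding S_def J(2) by (intro tendsto_intros)
      then show ?thesis by (simp add: resolvent_equation)
    qed
  qed
qed

end

text \<open>A strongly continuous semigroup is in general only exponentially bounded; a bound
  \<open>M\<close> uniform on the half-line is available here because either stability notion
  controls the motion under zero input.\<close>

locale bounded_extrapolated_system = extrapolated_system +
  fixes M :: real
  assumes T_bound: "t \<ge> 0 \<Longrightarrow> norm (T t) \<le> M"
begin

lemma TX_bound: "t \<ge> 0 \<Longrightarrow> norm (TX t z) \<le> M * norm z"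
  using norm_TX_le[of t z] T_bound[of t] by (meson mult_right_mono norm_ge_zero order_trans)

lemma M_nonneg: "M \<ge> 0"
  using T_bound[of 0] norm_ge_zero[of "T 0"] by linarith

lemma TX_tendsto_0: "((\<lambda>h. TX h z) \<longlongrightarrow> z) (at_right 0)"
proof (rule tendstoI)
  fix e :: real assume e: "e > 0"
  \<comment> \<open>The error splits into \<open>M * d\<close> for moving \<open>z - j x\<close>
    along the semigroup and two further terms below \<open>d\<close>; one more \<open>d\<close> is
    slack.\<close>
  define d where "d = e / (M + 3)"
  have d: "d > 0" using e M_nonneg by (simp add: d_def)
  have "z \<in> closure (range j)" using dense_j by simp
  then obtain x where x: "dist (j x) z < d" using d by (auto simp: closure_approachable)
  have "((\<lambda>h. T h x) \<longlongrightarrow> x) (at_right 0)" using semigroup by (simp add: C0_semigroup_def)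
  then have "((\<lambda>h. j (T h x)) \<longlongrightarrow> j x) (at_right 0)" by (rule bounded_linear.tendsto[OF bounded_linear_j])
  then have "eventually (\<lambda>h. dist (j (T h x)) (j x) < d) (at_right 0)" using d by (rule tendstoD)
  then show "eventually (\<lambda>h. dist (TX h z) z < e) (at_right 0)"
    using eventually_at_right_less[of 0]
  proof eventually_elim
    case (elim h)
    have "norm (TX h (z - j x)) \<le> M * d"
      using TX_bound[of h "z - j x"] elim x M_nonneg
      by (smt (verit, best) dist_norm norm_minus_commute mult_left_mono)
    moreover have "TX h z - z = TX h (z - j x) + (j (T h x) - j x) + (j x - z)"
      using elim by (simp add: blinfun.diff_right TX_j)
    ultimately have "norm (TX h z - z) < M * d + d + d"
      using elim x norm_triangle_ineq[of "TX h (z - j x) + (j (T h x) - j x)" "j x - z"]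
       norm_triangle_ineq[of "TX h (z - j x)" "j (T h x) - j x"] by (simp add: dist_norm)
    also have "\<dots> < (M + 3) * d" using d by (simp add: algebra_simps)
    also have "\<dots> = e" using M_nonneg by (simp add: d_def)
    finally show ?case by (simp add: dist_norm)
  qed
qed

text \<open>Approach from the right suffices and is easy: \<open>TX r\<close> factors out and only
  strong continuity at 0 remains. The grid used for measurability is chosen to approach from this
  side.\<close>

lemma TX_tendsto:
  assumes r: "r \<ge> 0" and s: "\<And>i. s i \<ge> r" and lim: "s \<longlonglongrightarrow> r"
  shows "(\<lambda>i. TX (s i) z) \<longlonglongrightarrow> TX r z"
proof -
  have c: "continuous (at 0 within {0..}) (\<lambda>h. TX h z)"
    using TX_tendsto_0[of z] at_within_Ici_at_right[of "0::real"] by (simp add: continuous_within)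
  have "(\<lambda>i. s i - r) \<longlonglongrightarrow> r - r" using lim by (intro tendsto_intros)
  then have "(\<lambda>i. TX (s i - r) z) \<longlonglongrightarrow> TX 0 z"
    using s by (intro continuous_within_tendsto_compose'[OF c]) auto
  then have "(\<lambda>i. TX r (TX (s i - r) z)) \<longlonglongrightarrow> TX r (TX 0 z)"
    by (rule bounded_linear.tendsto[OF blinfun.bounded_linear_right])
  moreover have "TX r (TX (s i - r) z) = TX (s i) z" for i
    using TX_add[of r "s i - r" z] r s[of i] by simp
  ultimately show ?thesis by simp
qed

end

section \<open>Mild solutions\<close>

text \<open>On the bounded interval the floor takes only finitely many integer values.\<close>

lemma simple_function_floor_grid:
  fixes t :: real and n :: nat
  shows "simple_function (lebesgue_on {0..t}) (\<lambda>x. of_int \<lfloor>real n * x\<rfloor> / real n)"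
proof (rule simple_function_borel_measurable)
  have "(\<lambda>x. of_int \<lfloor>real n * x\<rfloor> / real n) \<in> borel_measurable (lebesgue :: real measure)"
    by (rule measurable_completion) measurable
  then show "(\<lambda>x. of_int \<lfloor>real n * x\<rfloor> / real n) \<in> borel_measurable (lebesgue_on {0..t})"
    by (rule measurable_restrict_space1)
  have "(\<lambda>x. of_int \<lfloor>real n * x\<rfloor> / real n) ` space (lebesgue_on {0..t})
      \<subseteq> (\<lambda>k. of_int k / real n) ` {0..\<lfloor>real n * t\<rfloor>}"
    by (auto simp: space_restrict_space intro!: imageI floor_mono mult_left_mono)
  then show "finite ((\<lambda>x. of_int \<lfloor>real n * x\<rfloor> / real n) ` space (lebesgue_on {0..t}) :: real set)"
    by (rule finite_subset) simp
qed

lemma floor_grid_tendsto: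
  "(\<lambda>n. of_int \<lfloor>real (Suc n) * x\<rfloor> / real (Suc n)) \<longlonglongrightarrow> (x::real)"
proof (rule tendsto_sandwich)
  show "(\<lambda>n. x - inverse (real (Suc n))) \<longlonglongrightarrow> x"
    using tendsto_diff[OF tendsto_const LIMSEQ_inverse_real_of_nat, of x] by simp
  show "(\<lambda>n. x) \<longlonglongrightarrow> x" by simp
  show "\<forall>\<^sub>F n in sequentially. x - inverse (real (Suc n)) \<le> of_int \<lfloor>real (Suc n) * x\<rfloor> / real (Suc n)"
  proof (intro always_eventually allI)
    fix n
    have "real (Suc n) * x - 1 \<le> of_int \<lfloor>real (Suc n) * x\<rfloor>" by linarith
    then have "(real (Suc n) * x - 1) / real (Suc n) \<le> of_int \<lfloor>real (Suc n) * x\<rfloor> / real (Suc n)"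
      by (rule divide_right_mono) simp
    then show "x - inverse (real (Suc n)) \<le> of_int \<lfloor>real (Suc n) * x\<rfloor> / real (Suc n)"
      by (simp add: diff_divide_distrib inverse_eq_divide)
  qed
  show "\<forall>\<^sub>F n in sequentially. of_int \<lfloor>real (Suc n) * x\<rfloor> / real (Suc n) \<le> x"
  proof (intro always_eventually allI)
    fix n
    have "of_int \<lfloor>real (Suc n) * x\<rfloor> \<le> real (Suc n) * x" by linarith
    then show "of_int \<lfloor>real (Suc n) * x\<rfloor> / real (Suc n) \<le> x"
      by (simp add: pos_divide_le_eq mult.commute del: of_nat_Suc)
  qed
qed

lemma strongly_measurable_on_subset:
  fixes u :: "real \<Rightarrow> 'u::real_normed_vector"
  assumes "strongly_measurable (lebesgue_on S) u" and "S' \<subseteq> S" and S: "S \<in> sets lebesgue" "S' \<in> sets lebesgue"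
  shows "strongly_measurable (lebesgue_on S') u"
proof -
  have "strongly_measurable lebesgue (\<lambda>x. indicator S x *\<^sub>R u x)"
    using assms(1) strongly_measurable_restrict_space[OF S(1)] by blast
  then have "strongly_measurable lebesgue (\<lambda>x. indicator S' x *\<^sub>R indicator S x *\<^sub>R u x)"
    by (rule strongly_measurable_indicator[OF S(2)])
  also have "(\<lambda>x. indicator S' x *\<^sub>R indicator S x *\<^sub>R u x) = (\<lambda>x. indicator S' x *\<^sub>R u x)"
    using assms(2) by (auto simp: indicator_def fun_eq_iff)
  finally show ?thesis using strongly_measurable_restrict_space[OF S(2)] by blast
qed

text \<open>The class of inputs, independent of \<open>p\<close>, for which the convolution integral
  exists at every time; it is closed under the shifts in the cocycle identity. Negative
  \<open>t\<close> give an empty interval, hence no condition.\<close>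

definition local_input :: "(real \<Rightarrow> 'u::real_normed_vector) \<Rightarrow> bool" where
  "local_input u \<longleftrightarrow> (\<forall>t. strongly_measurable (lebesgue_on {0..t}) u \<and>
                       integrable (lebesgue_on {0..t}) (\<lambda>s. norm (u s)))"

lemma local_input_scale: "local_input u \<Longrightarrow> local_input (\<lambda>s. c *\<^sub>R u s)"
  unfolding local_input_def
  by (simp add: strongly_measurable_bounded_linear[OF bounded_linear_scaleR_right])

lemma local_input_shift:
  fixes u :: "real \<Rightarrow> 'u::real_normed_vector"
  assumes "local_input u" and c: "c \<ge> 0"
  shows "local_input (\<lambda>s. u (s + c))"
  unfolding local_input_def
proof (intro allI conjI)
  fix t
  have S: "{0..t} \<in> sets lebesgue" for t :: real by simp
  \<comment> \<open>For \<open>x\<close> in \<open>{0..t}\<close> the shifted point lies in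
    \<open>{0..t + c}\<close>, so cutting before the shift and again after it is the same as cutting
    after it only.\<close>
  have eq: "indicator {0..t} x *\<^sub>R indicator {0..t + c} (x + c) *\<^sub>R u (x + c) = indicator {0..t} x *\<^sub>R u (x + c)"
     "indicator {0..t} x *\<^sub>R indicator {0..t + c} (x + c) *\<^sub>R norm (u (x + c)) = indicator {0..t} x *\<^sub>R norm (u (x + c))" for x
    using c by (auto simp: indicator_def)
  have "strongly_measurable lebesgue (\<lambda>x. indicator {0..t + c} x *\<^sub>R u x)"
    using assms(1) strongly_measurable_restrict_space[OF S] unfolding local_input_def by blast
  from strongly_measurable_indicator[OF S strongly_measurable_comp[OF translation_lebesgue(1)[of c] translation_lebesgue(2)[of c] this], of t]
  show "strongly_measurable (lebesgue_on {0..t}) (\<lambda>s. u (s + c))"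
    unfolding eq by (rule strongly_measurable_restrict_space[OF S, THEN iffD2])
  have restrict: "integrable (lebesgue_on {0..t}) f \<longleftrightarrow> integrable lebesgue (\<lambda>x. indicator {0..t} x *\<^sub>R f x)"
    for t and f :: "real \<Rightarrow> real"
    by (rule integrable_restrict_space) simp
  have "integrable lebesgue (\<lambda>x. indicator {0..t + c} x *\<^sub>R norm (u x))"
    using assms(1) unfolding local_input_def restrict by blast
  then have "integrable (distr lebesgue lebesgue (\<lambda>x. x + c)) (\<lambda>x. indicator {0..t + c} x *\<^sub>R norm (u x))"
    by (simp add: translation_lebesgue)
  then have "integrable lebesgue (\<lambda>x. indicator {0..t + c} (x + c) *\<^sub>R norm (u (x + c)))"
    by (rule integrable_distr[OF translation_lebesgue(1)[of c]])
  from integrable_mult_indicator[OF S this, of t]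
  show "integrable (lebesgue_on {0..t}) (\<lambda>s. norm (u (s + c)))"
    unfolding eq restrict .
qed

context bounded_extrapolated_system
begin

text \<open>Time and input are discretised together: an operator depending on a finitely valued
  time, applied to a simple function, is again simple. Strong continuity handles the time error at
  the fixed vector \<open>f x\<close>, and the uniform bound \<open>M\<close> handles the error of
  the vector.\<close>

lemma strongly_measurable_integrand:
  assumes "strongly_measurable (lebesgue_on {0..t}) f"
  shows "strongly_measurable (lebesgue_on {0..t}) (\<lambda>s. TX (t - s) (f s))"
proof -
  obtain v where v: "\<And>i::nat. simple_function (lebesgue_on {0..t}) (v i)"
    "AE x in lebesgue_on {0..t}. (\<lambda>i. v i x) \<longlonglongrightarrow> f x"
    using assms unfolding strongly_measurable_def by blast
  \<comment> \<open>Rounding down keeps \<open>t - g i x\<close> at or above \<open>t - x\<close>,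
    the side from which \<open>TX_tendsto\<close> works.\<close>
  define g where "g i x = of_int \<lfloor>real (Suc i) * x\<rfloor> / real (Suc i)" for i and x :: real
  have g_le: "g i x \<le> x" for i x
  proof -
    have "of_int \<lfloor>real (Suc i) * x\<rfloor> \<le> real (Suc i) * x" by linarith
    then show ?thesis unfolding g_def by (simp add: pos_divide_le_eq mult.commute del: of_nat_Suc)
  qed
  have "AE x in lebesgue_on {0..t}. (\<lambda>i. TX (t - g i x) (v i x)) \<longlonglongrightarrow> TX (t - x) (f x)"
    using v(2) AE_space
  proof eventually_elim
    case (elim x)
    then have x: "0 \<le> x" "x \<le> t" by (auto simp: space_restrict_space)
    have "(\<lambda>i. t - g i x) \<longlonglongrightarrow> t - x"
      unfolding g_def by (intro tendsto_intros floor_grid_tendsto)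
    then have 1: "(\<lambda>i. TX (t - g i x) (f x)) \<longlonglongrightarrow> TX (t - x) (f x)"
      using x g_le by (intro TX_tendsto) auto
    have "(\<lambda>i. M * norm (v i x - f x)) \<longlonglongrightarrow> 0"
      using elim(1) by (intro tendsto_mult_right_zero tendsto_norm_zero) (simp add: LIM_zero)
    then have "(\<lambda>i. TX (t - g i x) (v i x - f x)) \<longlonglongrightarrow> 0"
      by (rule Lim_null_comparison[rotated])
        (use x order_trans[OF g_le x(2)] in \<open>auto intro!: always_eventually TX_bound\<close>)
    from tendsto_add[OF this 1] show ?case by (simp add: blinfun.diff_right)
  qed
  moreover have "simple_function (lebesgue_on {0..t}) (\<lambda>x. TX (t - g i x) (v i x))" for i
    using simple_function_compose2[OF simple_function_floor_grid[of t "Suc i"] v(1)[of i], where h="\<lambda>y z. TX (t - y) z"]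
    unfolding g_def .
  ultimately show ?thesis
    unfolding strongly_measurable_def by (intro exI[of _ "\<lambda>i x. TX (t - g i x) (v i x)"]) simp
qed

end

section \<open>The input map \<open>W\<close> and its cocycle identity\<close>

locale controlled_system = bounded_extrapolated_system T D A a j M
  for T :: "real \<Rightarrow> 'a::banach \<Rightarrow>\<^sub>L 'a" and D A a and j :: "'a \<Rightarrow> 'c::banach" and M +
  fixes B :: "'u::banach \<Rightarrow>\<^sub>L 'c"
begin

definition W :: "real \<Rightarrow> (real \<Rightarrow> 'u) \<Rightarrow> 'c" where
  "W t u = banach_integral (lebesgue_on {0..t}) (\<lambda>s. TX (t - s) (B (u s)))"

lemma mild_solution_W: "mild_solution j T B t x u = j (T t x) + W t u"
  by (simp add: mild_solution_def W_def)

lemma norm_integrand_le: "0 \<le> s \<Longrightarrow> s \<le> t \<Longrightarrow> norm (TX (t - s) (B (u s))) \<le> M * norm B * norm (u s)"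
  using TX_bound[of "t - s" "B (u s)"] norm_blinfun[of B "u s"] M_nonneg
  by (smt (verit, best) mult.assoc mult_left_mono)

lemma
  assumes "local_input u"
  shows strongly_measurable_W: "strongly_measurable (lebesgue_on {0..t}) (\<lambda>s. TX (t - s) (B (u s)))"
    and integrable_W: "integrable (lebesgue_on {0..t}) (\<lambda>s. norm (TX (t - s) (B (u s))))"
proof -
  have u: "strongly_measurable (lebesgue_on {0..t}) u" "integrable (lebesgue_on {0..t}) (\<lambda>s. norm (u s))"
    using assms by (auto simp: local_input_def)
  show 1: "strongly_measurable (lebesgue_on {0..t}) (\<lambda>s. TX (t - s) (B (u s)))"
    by (rule strongly_measurable_integrand[OF strongly_measurable_bounded_linear[OF blinfun.bounded_linear_right u(1)]])
  have "integrable (lebesgue_on {0..t}) (\<lambda>s. M * norm B * norm (u s))"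
    using u(2) by (rule integrable_mult_right)
  then show "integrable (lebesgue_on {0..t}) (\<lambda>s. norm (TX (t - s) (B (u s))))"
  proof (rule Bochner_Integration.integrable_bound)
    show "(\<lambda>s. norm (TX (t - s) (B (u s)))) \<in> borel_measurable (lebesgue_on {0..t})"
      by (rule strongly_measurable_norm[OF complete_lebesgue_on 1]) simp
    show "AE s in lebesgue_on {0..t}. norm (norm (TX (t - s) (B (u s)))) \<le> norm (M * norm B * norm (u s))"
    proof (rule AE_I2)
      fix s assume "s \<in> space (lebesgue_on {0..t})"
      then have "norm (TX (t - s) (B (u s))) \<le> M * norm B * norm (u s)"
        by (intro norm_integrand_le) (auto simp: space_restrict_space)
      then show "norm (norm (TX (t - s) (B (u s)))) \<le> norm (M * norm B * norm (u s))"
        by simp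
    qed
  qed
qed

lemma has_integral_W:
  "local_input u \<Longrightarrow> has_banach_integral (lebesgue_on {0..t}) (\<lambda>s. TX (t - s) (B (u s))) (W t u)"
  unfolding W_def
  by (intro has_banach_integral_banach_integral complete_lebesgue_on strongly_measurable_W integrable_W) auto

lemma W_eqI: "has_banach_integral (lebesgue_on {0..t}) (\<lambda>s. TX (t - s) (B (u s))) z \<Longrightarrow> W t u = z"
  unfolding W_def by (intro banach_integral_eq complete_lebesgue_on) auto

text \<open>Causality: this is what allows an input to be truncated at \<open>t\<close>, or extended
  to negative times, without changing the state reached.\<close>

lemma W_cong: "(\<And>s. 0 \<le> s \<Longrightarrow> s \<le> t \<Longrightarrow> u s = v s) \<Longrightarrow> local_input v \<Longrightarrow> W t u = W t v"
  by (rule W_eqI, rule has_banach_integral_cong_AE[OF has_integral_W]) (auto simp: space_restrict_space intro!: AE_I2)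

lemma W_add: "local_input u \<Longrightarrow> local_input v \<Longrightarrow> W t (\<lambda>s. u s + v s) = W t u + W t v"
  using has_banach_integral_add[OF complete_lebesgue_on has_integral_W[of u t] has_integral_W[of v t]]
  by (intro W_eqI) (simp add: blinfun.add_right)

lemma W_scale: "local_input u \<Longrightarrow> W t (\<lambda>s. c *\<^sub>R u s) = c *\<^sub>R W t u"
  using has_banach_integral_bounded_linear[OF complete_lebesgue_on bounded_linear_scaleR_right has_integral_W[of u t], of c]
  by (intro W_eqI) (simp add: blinfun.scaleR_right)

lemma W_zero: "W t (\<lambda>s. 0) = 0"
proof -
  have "local_input (\<lambda>s. 0::'u)" by (simp add: local_input_def strongly_measurable_simple)
  from W_scale[OF this, of t 0] show ?thesis by simp
qed

lemma norm_W_le: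
  assumes "local_input u"
  shows "norm (W t u) \<le> M * norm B * (\<integral>s. norm (u s) \<partial>lebesgue_on {0..t})"
proof -
  have "norm (W t u) \<le> (\<integral>s. norm (TX (t - s) (B (u s))) \<partial>lebesgue_on {0..t})"
    by (intro has_banach_integral_norm_le[OF complete_lebesgue_on has_integral_W] integrable_W assms) simp
  also have "\<dots> \<le> (\<integral>s. M * norm B * norm (u s) \<partial>lebesgue_on {0..t})"
    using assms
    by (intro integral_mono integrable_W integrable_mult_right)
       (auto simp: local_input_def space_restrict_space intro: norm_integrand_le)
  finally show ?thesis by simp
qed

text \<open>The integral over \<open>{0..t + s}\<close> is split at \<open>t\<close>. On the first
  piece \<open>TX s\<close> factors out of the integral; the second becomes an integral over
  \<open>{0..s}\<close> by translation.\<close>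

lemma W_cocycle:
  assumes u: "local_input u" and s: "s \<ge> 0" and t: "t \<ge> 0"
  shows "W (t + s) u = TX s (W t u) + W s (\<lambda>r. u (r + t))"
proof -
  define f where "f r = TX (t + s - r) (B (u r))" for r
  have S: "{0..t} \<in> sets lebesgue" for t :: real by simp
  have "has_banach_integral (lebesgue_on {0..t}) (\<lambda>r. TX s (TX (t - r) (B (u r)))) (TX s (W t u))"
    by (rule has_banach_integral_bounded_linear[OF complete_lebesgue_on[OF S] blinfun.bounded_linear_right has_integral_W[OF u]])
  then have "has_banach_integral (lebesgue_on {0..t}) f (TX s (W t u))"
    by (rule has_banach_integral_cong_AE)
      (auto simp: f_def space_restrict_space TX_add[OF s, symmetric] algebra_simps intro!: AE_I2)
  then have 1: "has_banach_integral lebesgue (\<lambda>r. indicator {0..t} r *\<^sub>R f r) (TX s (W t u))"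
    by (rule has_banach_integral_restrict_space[OF _ S])
  have "has_banach_integral lebesgue (\<lambda>r. indicator {0..s} r *\<^sub>R TX (s - r) (B (u (r + t)))) (W s (\<lambda>r. u (r + t)))"
    by (rule has_banach_integral_restrict_space[OF has_integral_W[OF local_input_shift[OF u t]] S])
  then have "has_banach_integral lebesgue
      (\<lambda>r. indicator {0..s} (r + - t) *\<^sub>R TX (s - (r + - t)) (B (u (r + - t + t)))) (W s (\<lambda>r. u (r + t)))"
  proof (rule has_banach_integral_comp[OF translation_lebesgue(1)[of "- t"] translation_lebesgue(2)[of "- t"] _ _ complete_lebesgue, rotated])
    show "(\<lambda>x. x + - t) ` space lebesgue = space lebesgue"
      by (auto simp: image_iff intro!: exI[where x="_ + t"])
  qed
  then have 2: "has_banach_integral lebesgue (\<lambda>r. indicator {t..t + s} r *\<^sub>R f r) (W s (\<lambda>r. u (r + t)))"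
    by (rule has_banach_integral_cong_AE) (auto simp: f_def indicator_def algebra_simps intro!: AE_I2)
  have 3: "has_banach_integral lebesgue (\<lambda>r. indicator {0..t + s} r *\<^sub>R f r) (W (t + s) u)"
    unfolding f_def by (rule has_banach_integral_restrict_space[OF has_integral_W[OF u] S])
  \<comment> \<open>Both pieces contain the point \<open>t\<close>, so the indicators add up only
    away from it.\<close>
  have "AE r in lebesgue. r \<noteq> t"
    by (rule AE_completion) (rule AE_lborel_singleton)
  then have "AE r in lebesgue. indicator {0..t} r *\<^sub>R f r + indicator {t..t + s} r *\<^sub>R f r = indicator {0..t + s} r *\<^sub>R f r"
    by eventually_elim (use s t in \<open>auto simp: indicator_def\<close>)
  from has_banach_integral_cong_AE[OF has_banach_integral_add[OF complete_lebesgue 1 2] this]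
  show ?thesis
    by (rule has_banach_integral_unique[OF complete_lebesgue 3])
qed

end

section \<open>The space of inputs\<close>

lemma complete_halfline: "complete_measure (lebesgue_on {0::real..})"
  by (rule complete_lebesgue_on) simp

lemma integrable_on_subset:
  fixes f :: "real \<Rightarrow> real"
  assumes f: "integrable (lebesgue_on S) f" and sub: "S' \<subseteq> S"
    and S: "S \<in> sets lebesgue" "S' \<in> sets lebesgue" and nonneg: "\<And>x. f x \<ge> 0"
  shows "integrable (lebesgue_on S') f"
    and "(\<integral>x. f x \<partial>lebesgue_on S') \<le> (\<integral>x. f x \<partial>lebesgue_on S)"
proof -
  have restrict: "integrable (lebesgue_on V) f \<longleftrightarrow> integrable lebesgue (\<lambda>x. indicator V x *\<^sub>R f x)"
     "(\<integral>x. f x \<partial>lebesgue_on V) = (\<integral>x. indicator V x *\<^sub>R f x \<partial>lebesgue)" if "V \<in> sets lebesgue" for V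
    by (rule integrable_restrict_space, use that in simp, rule integral_restrict_space, use that in simp)
  have i: "integrable lebesgue (\<lambda>x. indicator S x *\<^sub>R f x)" using f restrict S by blast
  have eq: "indicator S' x *\<^sub>R indicator S x *\<^sub>R f x = indicator S' x *\<^sub>R f x" for x
    using sub by (auto simp: indicator_def)
  have i': "integrable lebesgue (\<lambda>x. indicator S' x *\<^sub>R f x)"
    using integrable_mult_indicator[OF S(2) i] unfolding eq .
  then show "integrable (lebesgue_on S') f" using restrict S by blast
  show "(\<integral>x. f x \<partial>lebesgue_on S') \<le> (\<integral>x. f x \<partial>lebesgue_on S)"
    unfolding restrict(2)[OF S(1)] restrict(2)[OF S(2)]
    by (rule integral_mono[OF i' i]) (use sub nonneg in \<open>auto simp: indicator_def\<close>)
qed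

lemma Lp_inputs_AE_bound:
  fixes v :: "real \<Rightarrow> 'u::real_normed_vector"
  assumes v: "strongly_measurable (lebesgue_on {0..}) v"
    and h: "integrable (lebesgue_on {0..}) h" and le: "AE s in lebesgue_on {0..}. norm (v s) powr p \<le> h s"
  shows "v \<in> Lp_inputs p"
proof -
  have [measurable]: "(\<lambda>s. norm (v s)) \<in> borel_measurable (lebesgue_on {0..})"
    by (rule strongly_measurable_norm[OF complete_halfline v])
  have "integrable (lebesgue_on {0..}) (\<lambda>s. norm (v s) powr p)"
    by (rule Bochner_Integration.integrable_bound[OF h]) (use le in auto)
  with v show ?thesis by (simp add: Lp_inputs_def)
qed

lemma Lp_norm_nonneg: "Lp_norm p u \<ge> 0"
  by (simp add: Lp_norm_def)

lemma Lp_norm_powr: "p > 0 \<Longrightarrow> Lp_norm p u powr p = (\<integral>s. norm (u s) powr p \<partial>lebesgue_on {0..})"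
  by (simp add: Lp_norm_def powr_powr)

lemma Lp_norm_leI:
  assumes "p > 0" and "c \<ge> 0" and "(\<integral>s. norm (u s) powr p \<partial>lebesgue_on {0..}) \<le> c powr p"
  shows "Lp_norm p u \<le> c"
proof -
  have "Lp_norm p u \<le> (c powr p) powr (1 / p)"
    unfolding Lp_norm_def using assms by (intro powr_mono2) auto
  with assms show ?thesis by (simp add: powr_powr)
qed

lemma Lp_mono:
  fixes v :: "real \<Rightarrow> 'u::real_normed_vector" and u :: "real \<Rightarrow> 'v::real_normed_vector"
  assumes p: "p > 0" and u: "u \<in> Lp_inputs p" and v: "strongly_measurable (lebesgue_on {0..}) v"
    and c: "c \<ge> 0" and le: "\<And>s. norm (v s) \<le> c * norm (u s)"
  shows "v \<in> Lp_inputs p" and "Lp_norm p v \<le> c * Lp_norm p u"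
proof -
  have h: "integrable (lebesgue_on {0..}) (\<lambda>s. c powr p * norm (u s) powr p)"
    using u by (auto simp: Lp_inputs_def)
  have le': "norm (v s) powr p \<le> c powr p * norm (u s) powr p" for s
    using powr_mono2[OF _ _ le[of s], of p] p c by (simp add: powr_mult)
  show v': "v \<in> Lp_inputs p" by (rule Lp_inputs_AE_bound[OF v h]) (simp add: le')
  have "(\<integral>s. norm (v s) powr p \<partial>lebesgue_on {0..}) \<le> (\<integral>s. c powr p * norm (u s) powr p \<partial>lebesgue_on {0..})"
    using v' h le' by (intro integral_mono) (auto simp: Lp_inputs_def)
  also have "\<dots> = (c * Lp_norm p u) powr p"
    using p c by (simp add: powr_mult Lp_norm_nonneg Lp_norm_powr)
  finally show "Lp_norm p v \<le> c * Lp_norm p u"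
    by (intro Lp_norm_leI p mult_nonneg_nonneg c Lp_norm_nonneg)
qed

lemma
  fixes u :: "real \<Rightarrow> 'u::real_normed_vector"
  assumes "p > 0" and "u \<in> Lp_inputs p"
  shows Lp_inputs_scale: "(\<lambda>s. c *\<^sub>R u s) \<in> Lp_inputs p"
    and Lp_norm_scale_le: "Lp_norm p (\<lambda>s. c *\<^sub>R u s) \<le> \<bar>c\<bar> * Lp_norm p u"
proof -
  have "strongly_measurable (lebesgue_on {0..}) u" using assms by (simp add: Lp_inputs_def)
  then have "strongly_measurable (lebesgue_on {0..}) (\<lambda>s. c *\<^sub>R u s)"
    by (rule strongly_measurable_bounded_linear[OF bounded_linear_scaleR_right])
  from Lp_mono[OF assms this, of "\<bar>c\<bar>"]
  show "(\<lambda>s. c *\<^sub>R u s) \<in> Lp_inputs p" "Lp_norm p (\<lambda>s. c *\<^sub>R u s) \<le> \<bar>c\<bar> * Lp_norm p u" by simp_all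
qed

lemma Lp_inputs_add:
  fixes u v :: "real \<Rightarrow> 'u::real_normed_vector"
  assumes p: "p > 0" and u: "u \<in> Lp_inputs p" and v: "v \<in> Lp_inputs p"
  shows "(\<lambda>s. u s + v s) \<in> Lp_inputs p"
proof (rule Lp_inputs_AE_bound)
  show "strongly_measurable (lebesgue_on {0..}) (\<lambda>s. u s + v s)"
    using u v by (intro strongly_measurable_add) (auto simp: Lp_inputs_def)
  \<comment> \<open>The factor \<open>2 powr p\<close> comes from bounding the norm of a sum by
    twice the larger norm.\<close>
  show "integrable (lebesgue_on {0..}) (\<lambda>s. 2 powr p * (norm (u s) powr p + norm (v s) powr p))"
    using u v by (auto simp: Lp_inputs_def)
  show "AE s in lebesgue_on {0..}. norm (u s + v s) powr p \<le> 2 powr p * (norm (u s) powr p + norm (v s) powr p)"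
  proof (rule AE_I2)
    fix s
    have "norm (u s + v s) \<le> 2 * max (norm (u s)) (norm (v s))"
      using norm_triangle_ineq[of "u s" "v s"] by linarith
    then have "norm (u s + v s) powr p \<le> (2 * max (norm (u s)) (norm (v s))) powr p"
      using p by (intro powr_mono2) auto
    also have "\<dots> = 2 powr p * max (norm (u s)) (norm (v s)) powr p" by (simp add: powr_mult)
    also have "\<dots> \<le> 2 powr p * (norm (u s) powr p + norm (v s) powr p)"
      by (intro mult_left_mono) (auto simp: max_def)
    finally show "norm (u s + v s) powr p \<le> 2 powr p * (norm (u s) powr p + norm (v s) powr p)" .
  qed
qed

lemma Lp_inputs_diff:
  fixes u v :: "real \<Rightarrow> 'u::real_normed_vector"
  assumes "p > 0" "u \<in> Lp_inputs p" "v \<in> Lp_inputs p"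
  shows "(\<lambda>s. u s - v s) \<in> Lp_inputs p"
  using Lp_inputs_add[OF assms(1,2) Lp_inputs_scale[OF assms(1,3), of "-1"]] by simp

lemma Lp_inputs_zero: "(\<lambda>s. 0) \<in> Lp_inputs p"
  by (simp add: Lp_inputs_def strongly_measurable_simple)

text \<open>Both claims come from integrating \<open>r \<le> c * (1 + (r / c) powr p)\<close>. With
  \<open>c\<close> above the \<open>L_p\<close> norm the integral of the right side over
  \<open>{0..t}\<close> is at most \<open>c * (t + 1)\<close>.\<close>

lemma
  fixes u :: "real \<Rightarrow> 'u::real_normed_vector"
  assumes p: "p \<ge> 1" and u: "u \<in> Lp_inputs p"
  shows Lp_local_input: "local_input u"
    and Lp_integral_le: "t \<ge> 0 \<Longrightarrow> (\<integral>s. norm (u s) \<partial>lebesgue_on {0..t}) \<le> (t + 1) * Lp_norm p u"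
proof -
  have sm: "strongly_measurable (lebesgue_on {0..t}) u" for t
    by (rule strongly_measurable_on_subset[of "{0..}"]) (use u in \<open>auto simp: Lp_inputs_def\<close>)
  have ip: "integrable (lebesgue_on {0..t}) (\<lambda>s. norm (u s) powr p)"
      "(\<integral>s. norm (u s) powr p \<partial>lebesgue_on {0..t}) \<le> Lp_norm p u powr p" for t
    using integrable_on_subset[of "{0..}" "\<lambda>s. norm (u s) powr p" "{0..t}"] u p
    by (auto simp: Lp_inputs_def Lp_norm_powr)
  have c1: "integrable (lebesgue_on {0..t}) (\<lambda>s. 1::real)" for t :: real
    by (rule finite_measure.integrable_const, rule finite_measureI) (simp add: emeasure_restrict_space emeasure_lborel_Icc_eq)
  \<comment> \<open>For \<open>x \<le> 1\<close> the inequality \<open>x \<le> 1 + x powr p\<close>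
    is trivial, and for \<open>x > 1\<close> it uses \<open>p \<ge> 1\<close>; here
    \<open>x = norm (u s) / c\<close>.\<close>
  have le: "norm (u s) \<le> c * (1 + c powr (- p) * norm (u s) powr p)" if "c > 0" for c s
  proof -
    have "norm (u s) / c \<le> 1 + (norm (u s) / c) powr p"
    proof (cases "norm (u s) / c \<le> 1")
      case False
      then have "(norm (u s) / c) powr 1 \<le> (norm (u s) / c) powr p" using p by (intro powr_mono) auto
      with False that show ?thesis by simp
    qed (use that in \<open>simp add: add_increasing2\<close>)
    also have "(norm (u s) / c) powr p = c powr (- p) * norm (u s) powr p"
      using that by (simp add: powr_divide powr_minus_divide)
    finally show ?thesis using that by (simp add: pos_divide_le_eq mult.commute)
  qed
  have i: "integrable (lebesgue_on {0..t}) (\<lambda>s. norm (u s))" for t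
  proof (rule Bochner_Integration.integrable_bound[OF Bochner_Integration.integrable_add[OF c1 ip(1)]])
    show "(\<lambda>s. norm (u s)) \<in> borel_measurable (lebesgue_on {0..t})"
      by (rule strongly_measurable_norm[OF complete_lebesgue_on sm]) simp
  qed (use le[of 1] in auto)
  show "local_input u" using sm i by (auto simp: local_input_def)
  show "(\<integral>s. norm (u s) \<partial>lebesgue_on {0..t}) \<le> (t + 1) * Lp_norm p u" if t: "t \<ge> 0"
  proof -
    let ?I = "\<integral>s. norm (u s) \<partial>lebesgue_on {0..t}"
    have "?I / (t + 1) \<le> Lp_norm p u"
    proof (rule dense_ge)
      fix c assume c: "Lp_norm p u < c"
      then have c0: "c > 0" using Lp_norm_nonneg[of p u] by linarith
      have "?I \<le> (\<integral>s. c * (1 + c powr (- p) * norm (u s) powr p) \<partial>lebesgue_on {0..t})"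
        using le[OF c0] i c1 ip by (intro integral_mono) auto
      also have "\<dots> = c * (t + c powr (- p) * (\<integral>s. norm (u s) powr p \<partial>lebesgue_on {0..t}))"
        using c1[of t] ip(1)[of t] t by (simp add: measure_restrict_space)
      also have "\<dots> \<le> c * (t + c powr (- p) * c powr p)"
        using c c0 p ip(2)[of t] order_trans[OF ip(2) powr_mono2[of p "Lp_norm p u" c]] Lp_norm_nonneg[of p u]
        by (intro mult_left_mono add_left_mono) auto
      also have "c powr (- p) * c powr p = 1" using c0 by (simp flip: powr_add)
      finally show "?I / (t + 1) \<le> c" using t by (simp add: pos_divide_le_eq)
    qed
    then show ?thesis using t by (simp add: pos_divide_le_eq mult.commute)
  qed
qed

text \<open>The shift \<open>c\<close> may have either sign: a negative one delays the input and
  fills in zeros, a positive one discards an initial piece. Invariance of the integral over the line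
  under translation bounds the norm in both cases.\<close>

lemma
  fixes u :: "real \<Rightarrow> 'u::real_normed_vector"
  assumes p: "p > 0" and u: "u \<in> Lp_inputs p"
  shows Lp_inputs_translate: "(\<lambda>s. indicator {0..} (s + c) *\<^sub>R u (s + c)) \<in> Lp_inputs p"
    and Lp_norm_translate_le: "Lp_norm p (\<lambda>s. indicator {0..} (s + c) *\<^sub>R u (s + c)) \<le> Lp_norm p u"
proof -
  let ?v = "\<lambda>s. indicator {0..} (s + c) *\<^sub>R u (s + c)"
  let ?f = "\<lambda>s. indicator {0..} s *\<^sub>R norm (u s) powr p"
  have H: "{0::real..} \<in> sets lebesgue" by simp
  have restrict: "integrable (lebesgue_on {0..}) f \<longleftrightarrow> integrable lebesgue (\<lambda>x. indicator {0..} x *\<^sub>R f x)"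
     "(\<integral>x. f x \<partial>lebesgue_on {0..}) = (\<integral>x. indicator {0..} x *\<^sub>R f x \<partial>lebesgue)" for f :: "real \<Rightarrow> real"
    by (rule integrable_restrict_space, simp, rule integral_restrict_space, simp)
  have "strongly_measurable lebesgue (\<lambda>s. indicator {0..} s *\<^sub>R u s)"
    using u strongly_measurable_restrict_space[OF H] by (auto simp: Lp_inputs_def)
  from strongly_measurable_indicator[OF H strongly_measurable_comp[OF translation_lebesgue(1)[of c] translation_lebesgue(2)[of c] this]]
  have sm: "strongly_measurable (lebesgue_on {0..}) ?v"
    by (rule strongly_measurable_restrict_space[OF H, THEN iffD2])
  have f: "integrable lebesgue ?f" using u by (simp add: Lp_inputs_def restrict)
  then have "integrable (distr lebesgue lebesgue (\<lambda>x. x + c)) ?f"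
    by (simp add: translation_lebesgue)
  then have fc: "integrable lebesgue (\<lambda>s. ?f (s + c))"
    by (rule integrable_distr[OF translation_lebesgue(1)[of c]])
  have v_eq: "norm (?v s) powr p = ?f (s + c)" for s using p by (auto simp: indicator_def)
  have int: "integrable lebesgue (\<lambda>s. indicator {0..} s *\<^sub>R ?f (s + c))"
    by (rule integrable_mult_indicator[OF H fc])
  have "integrable (lebesgue_on {0..}) (\<lambda>s. norm (?v s) powr p)"
    unfolding restrict v_eq by (rule int)
  with sm show "?v \<in> Lp_inputs p"
    unfolding Lp_inputs_def by (intro CollectI conjI)
  have "(\<integral>s. norm (?v s) powr p \<partial>lebesgue_on {0..}) \<le> (\<integral>s. ?f (s + c) \<partial>lebesgue)"
    unfolding restrict(2) v_eq by (rule integral_mono[OF int fc]) (auto simp: indicator_def)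
  also have "\<dots> = (\<integral>s. ?f s \<partial>distr lebesgue lebesgue (\<lambda>x. x + c))"
    using f by (intro integral_distr[symmetric] translation_lebesgue) auto
  also have "\<dots> = (\<integral>s. norm (u s) powr p \<partial>lebesgue_on {0..})"
    by (simp add: translation_lebesgue restrict)
  also have "\<dots> = Lp_norm p u powr p" using p by (simp add: Lp_norm_powr)
  finally show "Lp_norm p ?v \<le> Lp_norm p u"
    by (rule Lp_norm_leI[OF p Lp_norm_nonneg])
qed

lemma Lp_norm_tendsto_0:
  fixes u :: "nat \<Rightarrow> real \<Rightarrow> 'u::real_normed_vector"
  assumes p: "p > 0" and u: "\<And>i. u i \<in> Lp_inputs p"
    and h: "integrable (lebesgue_on {0..}) h"
    and le: "\<And>i. AE s in lebesgue_on {0..}. norm (u i s) powr p \<le> h s"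
    and lim: "AE s in lebesgue_on {0..}. (\<lambda>i. u i s) \<longlonglongrightarrow> 0"
  shows "(\<lambda>i. Lp_norm p (u i)) \<longlonglongrightarrow> 0"
proof -
  have "(\<lambda>i. \<integral>s. norm (u i s) powr p \<partial>lebesgue_on {0..}) \<longlonglongrightarrow> (\<integral>s. 0 \<partial>lebesgue_on {0::real..})"
  proof (rule integral_dominated_convergence[where w=h])
    show "AE s in lebesgue_on {0..}. (\<lambda>i. norm (u i s) powr p) \<longlonglongrightarrow> 0"
      using lim
    proof eventually_elim
      case (elim s)
      show ?case using p by (intro tendsto_zero_powrI[OF tendsto_norm_zero[OF elim] tendsto_const]) auto
    qed
  qed (use u h le in \<open>auto simp: Lp_inputs_def\<close>)
  then show ?thesis
    unfolding Lp_norm_def using p by (intro tendsto_zero_powrI[OF _ tendsto_const]) auto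
qed

lemma Lp_simple_approximation:
  fixes u :: "real \<Rightarrow> 'u::real_normed_vector"
  assumes p: "p > 0" and u: "u \<in> Lp_inputs p"
  obtains s where "\<And>i::nat. simple_function (lebesgue_on {0..}) (s i)" "\<And>i. s i \<in> Lp_inputs p"
    "\<And>i. Lp_norm p (s i) \<le> 2 * Lp_norm p u" "(\<lambda>i. Lp_norm p (\<lambda>x. u x - s i x)) \<longlonglongrightarrow> 0"
proof -
  have sm: "strongly_measurable (lebesgue_on {0..}) u" using u by (simp add: Lp_inputs_def)
  obtain s where s: "\<And>i::nat. simple_function (lebesgue_on {0..}) (s i)" "\<And>i x. norm (s i x) \<le> 2 * norm (u x)"
    "AE x in lebesgue_on {0..}. (\<lambda>i. s i x) \<longlonglongrightarrow> u x"
    by (rule strongly_measurable_dominated[OF complete_halfline sm]) (rule that)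
  note mono = Lp_mono[OF p u strongly_measurable_simple[OF s(1)] zero_le_numeral s(2)]
  have "(\<lambda>i. Lp_norm p (\<lambda>x. u x - s i x)) \<longlonglongrightarrow> 0"
  proof (rule Lp_norm_tendsto_0[OF p])
    show "(\<lambda>x. u x - s i x) \<in> Lp_inputs p" for i by (rule Lp_inputs_diff[OF p u mono(1)])
    show "integrable (lebesgue_on {0..}) (\<lambda>x. 3 powr p * norm (u x) powr p)"
      using u by (auto simp: Lp_inputs_def)
    show "AE x in lebesgue_on {0..}. norm (u x - s i x) powr p \<le> 3 powr p * norm (u x) powr p" for i
    proof (rule AE_I2)
      fix x
      have "norm (u x - s i x) \<le> 3 * norm (u x)"
        using norm_triangle_ineq4[of "u x" "s i x"] s(2)[of i x] by simp
      then have "norm (u x - s i x) powr p \<le> (3 * norm (u x)) powr p" using p by (intro powr_mono2) auto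
      then show "norm (u x - s i x) powr p \<le> 3 powr p * norm (u x) powr p" by (simp add: powr_mult)
    qed
    show "AE x in lebesgue_on {0..}. (\<lambda>i. u x - s i x) \<longlonglongrightarrow> 0"
      using s(3)
    proof eventually_elim
      case (elim x)
      show ?case using tendsto_diff[OF tendsto_const elim, of "u x"] by simp
    qed
  qed
  with s(1) mono show ?thesis by (intro that[of s])
qed

text \<open>A completeness argument in the style of Riesz and Fischer. One integrable function
  \<open>h\<close> majorises suitably weighted p-th powers of all terms, so almost everywhere the
  series converges absolutely, and all partial sums are bounded by
  \<open>H = h powr (1 / p)\<close>, whose p-th power is integrable.\<close>

lemma Lp_simple_series:
  fixes d :: "nat \<Rightarrow> real \<Rightarrow> 'u::banach"
  assumes p: "p \<ge> 1" and simple: "\<And>k. simple_function (lebesgue_on {0..}) (d k)"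
    and d: "\<And>k. d k \<in> Lp_inputs p" and small: "\<And>k. Lp_norm p (d k) \<le> (1 / 3) ^ k"
  obtains v where "v \<in> Lp_inputs p" "(\<lambda>m. Lp_norm p (\<lambda>s. v s - (\<Sum>k<m. d k s))) \<longlonglongrightarrow> 0"
proof -
  let ?L = "lebesgue_on {0::real..}"
  have p0: "p > 0" using p by simp
  \<comment> \<open>The weight \<open>2 ^ Suc k\<close> is chosen between two needs: the integrals
    of \<open>b k\<close> must stay summable against \<open>(1 / 3) ^ k\<close>, and
    \<open>b k s \<le> h s\<close> must give the summable bound \<open>H s / 2 ^ Suc k\<close> for
    the k-th term.\<close>
  define b where "b k s = (2 ^ Suc k * norm (d k s)) powr p" for k s
  have b_int: "integrable ?L (b k)" for k
    using d[of k] unfolding b_def by (simp add: powr_mult Lp_inputs_def)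
  have b_le: "(\<integral>s. b k s \<partial>?L) \<le> 2 powr p * (2 / 3) ^ k" for k
  proof -
    have "(\<integral>s. b k s \<partial>?L) = (2 ^ Suc k) powr p * Lp_norm p (d k) powr p"
      unfolding b_def Lp_norm_powr[OF p0] by (simp add: powr_mult)
    also have "\<dots> \<le> (2 ^ Suc k) powr p * ((1 / 3) ^ k) powr p"
      using small[of k] p0 by (intro mult_left_mono powr_mono2) (auto simp: Lp_norm_nonneg)
    also have "\<dots> = 2 powr p * ((2 / 3) ^ k) powr p"
      by (simp add: powr_mult[symmetric] power_mult_distrib[symmetric] mult.assoc)
    \<comment> \<open>A number in [0,1] raised to a power \<open>p \<ge> 1\<close> does not
      grow.\<close>
    also have "\<dots> \<le> 2 powr p * ((2 / 3) ^ k) powr 1"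
      using p by (intro mult_left_mono powr_mono') (auto simp: power_le_one)
    finally show ?thesis by simp
  qed
  have b0: "b k s \<ge> 0" for k s by (simp add: b_def)
  have [measurable]: "b k \<in> borel_measurable ?L" for k using b_int by auto
  have fin: "(\<integral>\<^sup>+s. (\<Sum>k. ennreal (b k s)) \<partial>?L) \<noteq> \<infinity>"
  proof -
    have "(\<integral>\<^sup>+s. (\<Sum>k. ennreal (b k s)) \<partial>?L) = (\<Sum>k. \<integral>\<^sup>+s. ennreal (b k s) \<partial>?L)"
      by (rule nn_integral_suminf) measurable
    also have "\<dots> \<le> (\<Sum>k. ennreal (2 powr p * (2 / 3) ^ k))"
      using b_le b_int b0
      by (intro suminf_le summableI) (simp add: nn_integral_eq_integral ennreal_leI)
    also have "\<dots> = ennreal (\<Sum>k. 2 powr p * (2 / 3) ^ k)"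
      by (intro suminf_ennreal2 summable_mult summable_geometric) auto
    finally show ?thesis by (auto simp: top_unique)
  qed
  then have ae: "AE s in ?L. (\<Sum>k. ennreal (b k s)) \<noteq> \<infinity>"
    by (intro nn_integral_PInf_AE) auto
  \<comment> \<open>Where the series diverges the value is unspecified; this happens only on a null
    set.\<close>
  define h where "h s = (\<Sum>k. b k s)" for s
  have summ: "AE s in ?L. summable (\<lambda>k. b k s)"
    using ae by eventually_elim (rule summable_suminf_not_top, auto simp: b0)
  have h_meas [measurable]: "h \<in> borel_measurable ?L" unfolding h_def by measurable
  have h_int: "integrable ?L h"
  proof (rule integrableI_bounded[OF h_meas])
    have "(\<integral>\<^sup>+s. ennreal (norm (h s)) \<partial>?L) = (\<integral>\<^sup>+s. (\<Sum>k. ennreal (b k s)) \<partial>?L)"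
    proof (rule nn_integral_cong_AE)
      show "AE s in ?L. ennreal (norm (h s)) = (\<Sum>k. ennreal (b k s))"
        using summ
      proof eventually_elim
        case (elim s)
        then show ?case unfolding h_def
          by (subst suminf_ennreal2) (auto simp: b0 suminf_nonneg)
      qed
    qed
    then show "(\<integral>\<^sup>+s. ennreal (norm (h s)) \<partial>?L) < \<infinity>" using fin by (simp add: less_top)
  qed
  define H where "H s = h s powr (1 / p)" for s
  define v where "v s = (\<Sum>k. d k s)" for s
  define f where "f m s = (\<Sum>k<m. d k s)" for m s
  have main: "AE s in ?L. (\<lambda>m. f m s) \<longlonglongrightarrow> v s \<and> (\<forall>m. norm (f m s) \<le> H s) \<and> norm (v s) \<le> H s \<and> H s powr p = h s \<and> H s \<ge> 0"
    using summ
  proof eventually_elim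
    case (elim s)
    have h0: "h s \<ge> 0" unfolding h_def using elim b0 by (intro suminf_nonneg) auto
    have dk: "norm (d k s) \<le> H s * (1 / 2) ^ Suc k" for k
    proof -
      have "b k s \<le> h s"
        unfolding h_def using sum_le_suminf[OF elim, of "{k}"] b0 by auto
      then have "b k s powr (1 / p) \<le> H s" unfolding H_def using p0 b0 by (intro powr_mono2) auto
      then have "2 ^ Suc k * norm (d k s) \<le> H s" using p0 by (simp add: b_def powr_powr)
      then show ?thesis by (simp add: field_simps)
    qed
    have H0: "H s \<ge> 0" by (simp add: H_def)
    have geo: "(\<lambda>k. H s * (1 / 2) ^ Suc k) sums (H s * 1)"
      by (intro sums_mult power_half_series)
    have sd: "summable (\<lambda>k. d k s)"
      by (rule summable_comparison_test[OF _ sums_summable[OF geo]]) (use dk in blast)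
    have 1: "(\<lambda>m. f m s) \<longlonglongrightarrow> v s"
      unfolding f_def v_def using summable_LIMSEQ[OF sd] .
    have 2: "norm (f m s) \<le> H s" for m
    proof -
      have "norm (f m s) \<le> (\<Sum>k<m. H s * (1 / 2) ^ Suc k)"
        unfolding f_def by (rule sum_norm_le) (rule dk)
      also have "\<dots> \<le> (\<Sum>k. H s * (1 / 2) ^ Suc k)"
        by (rule sum_le_suminf[OF sums_summable[OF geo]]) (use H0 in auto)
      also have "\<dots> = H s" using sums_unique[OF geo] by simp
      finally show ?thesis .
    qed
    have 3: "norm (v s) \<le> H s"
      by (rule LIMSEQ_le_const2[OF tendsto_norm[OF 1]]) (use 2 in blast)
    have "H s powr p = h s" using p0 h0 by (simp add: H_def powr_powr)
    with 1 2 3 H0 show ?case by blast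
  qed
  have f_simple: "simple_function ?L (f m)" for m
    unfolding f_def
  proof (induction m)
    case 0 show ?case by simp
  next
    case (Suc m)
    from simple_function_compose2[OF Suc simple[of m], where h="(+)"] show ?case by simp
  qed
  have v_sm: "strongly_measurable ?L v"
    unfolding strongly_measurable_def using main f_simple by (intro exI[of _ f]) auto
  have v: "v \<in> Lp_inputs p"
  proof (rule Lp_inputs_AE_bound[OF v_sm h_int])
    show "AE s in ?L. norm (v s) powr p \<le> h s"
      using main
    proof eventually_elim
      case (elim s)
      then show ?case using powr_mono2[of p "norm (v s)" "H s"] p0 by simp
    qed
  qed
  have fm: "f m \<in> Lp_inputs p" for m
  proof (rule Lp_inputs_AE_bound[OF strongly_measurable_simple[OF f_simple] h_int])
    show "AE s in ?L. norm (f m s) powr p \<le> h s"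
      using main
    proof eventually_elim
      case (elim s)
      then show ?case using powr_mono2[of p "norm (f m s)" "H s"] p0 by simp
    qed
  qed
  have "(\<lambda>m. Lp_norm p (\<lambda>s. v s - f m s)) \<longlonglongrightarrow> 0"
  proof (rule Lp_norm_tendsto_0[OF p0])
    show "(\<lambda>s. v s - f m s) \<in> Lp_inputs p" for m by (rule Lp_inputs_diff[OF p0 v fm])
    show "integrable ?L (\<lambda>s. 2 powr p * h s)" using h_int by simp
    show "AE s in ?L. norm (v s - f m s) powr p \<le> 2 powr p * h s" for m
      using main
    proof eventually_elim
      case (elim s)
      have "norm (v s) \<le> H s" "norm (f m s) \<le> H s" using elim by auto
      then have "norm (v s - f m s) \<le> 2 * H s"
        using norm_triangle_ineq4[of "v s" "f m s"] by linarith
      then have "norm (v s - f m s) powr p \<le> (2 * H s) powr p" using p0 by (intro powr_mono2) auto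
      then show ?case using elim by (simp add: powr_mult)
    qed
    show "AE s in ?L. (\<lambda>m. v s - f m s) \<longlonglongrightarrow> 0"
      using main
    proof eventually_elim
      case (elim s)
      then have "(\<lambda>m. f m s) \<longlonglongrightarrow> v s" by blast
      from tendsto_diff[OF tendsto_const this, of "v s"] show ?case by simp
    qed
  qed
  with v show ?thesis by (intro that[of v]) (simp_all add: f_def)
qed

section \<open>Uniform boundedness on the space of inputs\<close>

text \<open>
  A gliding hump argument: the series of small increments is built from simple functions only, so
  that its sum is strongly measurable for free, and the sign of each increment is chosen such that
  the \<open>n k\<close>-th operator is large at the partial sum.
\<close>

lemma Lp_uniform_boundedness:
  fixes G :: "nat \<Rightarrow> (real \<Rightarrow> 'u::banach) \<Rightarrow> 'a::real_normed_vector"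
  assumes p: "p \<ge> 1"
    and add: "\<And>n u v. u \<in> Lp_inputs p \<Longrightarrow> v \<in> Lp_inputs p \<Longrightarrow> G n (\<lambda>s. u s + v s) = G n u + G n v"
    and scale: "\<And>n u c. u \<in> Lp_inputs p \<Longrightarrow> G n (\<lambda>s. c *\<^sub>R u s) = c *\<^sub>R G n u"
    and bounded: "\<And>n. \<exists>K. \<forall>u\<in>Lp_inputs p. norm (G n u) \<le> K * Lp_norm p u"
    and pointwise: "\<And>u. u \<in> Lp_inputs p \<Longrightarrow> \<exists>C. \<forall>n. norm (G n u) \<le> C"
  shows "\<exists>C. \<forall>n. \<forall>u\<in>Lp_inputs p. norm (G n u) \<le> C * Lp_norm p u"
proof -
  have p0: "p > 0" using p by simp
  let ?L = "lebesgue_on {0::real..}"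
  obtain K where K: "\<And>n u. u \<in> Lp_inputs p \<Longrightarrow> norm (G n u) \<le> K n * Lp_norm p u"
    using bounded by metis
  have diff: "G n (\<lambda>s. u s - v s) = G n u - G n v" if "u \<in> Lp_inputs p" "v \<in> Lp_inputs p" for n u v
    using add[OF that(1) Lp_inputs_scale[OF p0 that(2), of "-1"]] scale[OF that(2), of n "-1"] by simp
  have cont: "(\<lambda>m. G n (f m)) \<longlonglongrightarrow> G n u"
    if "u \<in> Lp_inputs p" "\<And>m. f m \<in> Lp_inputs p" "(\<lambda>m. Lp_norm p (\<lambda>s. u s - f m s)) \<longlonglongrightarrow> 0" for n u f
  proof -
    have "(\<lambda>m. K n * Lp_norm p (\<lambda>s. u s - f m s)) \<longlonglongrightarrow> 0"
      by (rule tendsto_mult_right_zero[OF that(3)])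
    moreover have "norm (G n u - G n (f m)) \<le> K n * Lp_norm p (\<lambda>s. u s - f m s)" for m
      using K[OF Lp_inputs_diff[OF p0 that(1) that(2)[of m]], of n] by (simp add: diff that)
    ultimately have "(\<lambda>m. G n u - G n (f m)) \<longlonglongrightarrow> 0"
      using Lim_null_comparison[of "\<lambda>m. G n u - G n (f m)" "\<lambda>m. K n * Lp_norm p (\<lambda>s. u s - f m s)" sequentially]
      by simp
    from tendsto_diff[OF tendsto_const this, of "G n u"] show ?thesis by simp
  qed
  define S where "S = {w :: real \<Rightarrow> 'u. w \<in> Lp_inputs p \<and> simple_function ?L w}"
  define U where "U = {w \<in> S. Lp_norm p w \<le> 1}"
  \<comment> \<open>The operator norm of \<open>G n\<close> restricted to simple inputs; it is a
    genuine supremum because each \<open>G n\<close> is bounded.\<close>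
  define Q where "Q n = (SUP w\<in>U. norm (G n w))" for n
  have zero: "(\<lambda>s. 0) \<in> U"
    using p0 by (simp add: U_def S_def Lp_inputs_zero Lp_norm_def)
  have bdd: "bdd_above ((\<lambda>w. norm (G n w)) ` U)" for n
  proof (rule bdd_aboveI2)
    fix w assume w: "w \<in> U"
    have "norm (G n w) \<le> K n * Lp_norm p w" using K w by (simp add: U_def S_def)
    also have "\<dots> \<le> \<bar>K n\<bar> * 1"
      using w Lp_norm_nonneg[of p w] by (intro mult_mono) (auto simp: U_def)
    finally show "norm (G n w) \<le> \<bar>K n\<bar>" by simp
  qed
  have Q_upper: "norm (G n w) \<le> Q n" if "w \<in> U" for n w
    unfolding Q_def by (rule cSUP_upper[OF that bdd])
  have Q0: "Q n \<ge> 0" for n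
    using Q_upper[OF zero, of n] norm_ge_zero order_trans by blast
  have S_scale: "(\<lambda>s. c *\<^sub>R w s) \<in> S" if "w \<in> S" for c w
    using that Lp_inputs_scale[OF p0] simple_function_compose1[of ?L w "\<lambda>x. c *\<^sub>R x"] by (auto simp: S_def)
  have Q_le: "norm (G n w) \<le> Q n * c" if w: "w \<in> S" and c: "Lp_norm p w \<le> c" "c > 0" for n w c
  proof -
    have wL: "w \<in> Lp_inputs p" using w by (simp add: S_def)
    have "Lp_norm p (\<lambda>s. inverse c *\<^sub>R w s) \<le> \<bar>inverse c\<bar> * Lp_norm p w"
      by (rule Lp_norm_scale_le[OF p0 wL])
    also have "\<dots> \<le> 1" using c by (simp add: field_simps)
    finally have "(\<lambda>s. inverse c *\<^sub>R w s) \<in> U" using S_scale[OF w] by (simp add: U_def)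
    from Q_upper[OF this, of n] show ?thesis using c by (simp add: scale[OF wL] field_simps)
  qed
  have "\<exists>C. \<forall>n. Q n \<le> C"
  proof (rule ccontr)
    assume "\<nexists>C. \<forall>n. Q n \<le> C"
    \<comment> \<open>At stage \<open>k\<close> the increment contributes at least
      \<open>2 / 3\<close> and all later ones at most \<open>1 / 2\<close>, in units of
      \<open>Q (n k) / 3 ^ k\<close>. The remaining \<open>1 / 6\<close> must exceed
      \<open>Suc k\<close>.\<close>
    then have "\<exists>n. Q n > 6 * 3 ^ k * real (Suc k)" for k
      by (metis not_le)
    then obtain n where n: "\<And>k. Q (n k) > 6 * 3 ^ k * real (Suc k)" by metis
    \<comment> \<open>Any fraction above \<open>1 / 2\<close> of the supremum would beat the tail of
      the series; \<open>Q (n k) > 0\<close> makes it strictly smaller than the supremum, hence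
      exceeded.\<close>
    have "\<exists>w\<in>U. norm (G (n k) w) > (2 / 3) * Q (n k)" for k
    proof -
      have "Q (n k) > 0" by (rule le_less_trans[OF _ n]) simp
      then have *: "(2 / 3) * Q (n k) < Q (n k)" by simp
      have "U \<noteq> {}" using zero by blast
      from less_cSUP_iff[OF this bdd, of "(2 / 3) * Q (n k)" "n k"] * show ?thesis
        unfolding Q_def[symmetric] by blast
    qed
    then obtain w where w: "\<And>k. w k \<in> U" "\<And>k. norm (G (n k) (w k)) > (2 / 3) * Q (n k)" by metis
    define \<delta> where "\<delta> k s = ((1 / 3) ^ k) *\<^sub>R w k s" for k s
    have wS: "w k \<in> S" "w k \<in> Lp_inputs p" for k using w(1)[of k] by (auto simp: U_def S_def)
    have \<delta>S: "\<delta> k \<in> S" for k unfolding \<delta>_def by (rule S_scale[OF wS(1)])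
    have \<delta>L: "\<delta> k \<in> Lp_inputs p" for k using \<delta>S by (simp add: S_def)
    have \<delta>_small: "Lp_norm p (\<delta> k) \<le> (1 / 3) ^ k" for k
    proof -
      have "Lp_norm p (\<delta> k) \<le> \<bar>(1 / 3) ^ k\<bar> * Lp_norm p (w k)"
        unfolding \<delta>_def by (rule Lp_norm_scale_le[OF p0 wS(2)])
      also have "\<dots> \<le> (1 / 3) ^ k * 1"
        using w(1)[of k] by (intro mult_mono) (auto simp: U_def Lp_norm_nonneg)
      finally show ?thesis by simp
    qed
    have G\<delta>: "norm (G (n k) (\<delta> k)) \<ge> (2 / 3) * (1 / 3) ^ k * Q (n k)" for k
      unfolding \<delta>_def scale[OF wS(2)] using w(2)[of k] by (simp add: field_simps)
    define x where "x = rec_nat (\<lambda>s. 0) (\<lambda>k y. if norm (G (n k) (\<lambda>s. y s + \<delta> k s)) \<ge> norm (G (n k) (\<delta> k))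
       then (\<lambda>s. y s + \<delta> k s) else (\<lambda>s. y s - \<delta> k s))"
    define e where "e k = (if norm (G (n k) (\<lambda>s. x k s + \<delta> k s)) \<ge> norm (G (n k) (\<delta> k)) then 1 else - 1 :: real)" for k
    define d where "d k s = e k *\<^sub>R \<delta> k s" for k s
    have x_0: "x 0 = (\<lambda>s. 0)" by (simp add: x_def)
    have x_Suc: "x (Suc k) = (\<lambda>s. x k s + d k s)" for k
      by (auto simp: x_def d_def e_def fun_eq_iff)
    have abs_e: "\<bar>e k\<bar> = 1" for k by (simp add: e_def)
    have dS: "d k \<in> S" for k unfolding d_def by (rule S_scale[OF \<delta>S])
    have dL: "d k \<in> Lp_inputs p" for k using dS by (simp add: S_def)
    have d_small: "Lp_norm p (d k) \<le> (1 / 3) ^ k" for k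
      using Lp_norm_scale_le[OF p0 \<delta>L[of k], of "e k"] \<delta>_small[of k] by (simp add: d_def[abs_def] abs_e)
    have xL: "x k \<in> Lp_inputs p" for k
      by (induction k) (auto simp: x_0 x_Suc Lp_inputs_zero intro: Lp_inputs_add[OF p0 _ dL])
    have x_sum: "x m s = (\<Sum>k<m. d k s)" for m s
      by (induction m) (simp_all add: x_0 x_Suc)
    have hump: "norm (G (n k) (x (Suc k))) \<ge> (2 / 3) * (1 / 3) ^ k * Q (n k)" for k
    proof -
      have "norm (G (n k) (x (Suc k))) \<ge> norm (G (n k) (\<delta> k))"
      proof (cases "norm (G (n k) (\<lambda>s. x k s + \<delta> k s)) \<ge> norm (G (n k) (\<delta> k))")
        case True
        then show ?thesis by (simp add: x_Suc d_def e_def)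
      next
        case False
        let ?a = "G (n k) (x k)" and ?b = "G (n k) (\<delta> k)"
        have "norm (?a + ?b) < norm ?b" using False by (simp add: add[OF xL \<delta>L])
        \<comment> \<open>Twice \<open>?b\<close> is the difference of \<open>?a + ?b\<close> and
          \<open>?a - ?b\<close>, so one of the two is at least as long as \<open>?b\<close>; if the
          plus sign fails, the minus sign works.\<close>
        moreover have "2 * norm ?b \<le> norm (?a + ?b) + norm (?a - ?b)"
          using norm_triangle_ineq4[of "?a + ?b" "?a - ?b"] by (simp flip: scaleR_2)
        ultimately have "norm (?a - ?b) \<ge> norm ?b" by simp
        then show ?thesis using False by (simp add: x_Suc d_def e_def diff[OF xL \<delta>L])
      qed
      with G\<delta>[of k] show ?thesis by simp
    qed
    obtain v where v: "v \<in> Lp_inputs p" "(\<lambda>m. Lp_norm p (\<lambda>s. v s - (\<Sum>k<m. d k s))) \<longlonglongrightarrow> 0"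
      by (rule Lp_simple_series[OF p _ dL d_small]) (use dS in \<open>simp add: S_def\<close>, rule that)
    \<comment> \<open>The last factor is the exact value of the finite geometric sum of
      \<open>(1 / 3) ^ (Suc k + i)\<close> over \<open>i < m\<close>; this form goes through the
      induction.\<close>
    have tail: "norm (G i (x (Suc k + m)) - G i (x (Suc k))) \<le> Q i * ((1 / 3) ^ k / 2 * (1 - (1 / 3) ^ m))" for i k m
    proof (induction m)
      case (Suc m)
      have "G i (x (Suc k + Suc m)) - G i (x (Suc k)) = (G i (x (Suc k + m)) - G i (x (Suc k))) + G i (d (Suc k + m))"
        using add[OF xL dL, of i "Suc k + m" "Suc k + m"] x_Suc[of "Suc k + m"] by simp
      also have "norm \<dots> \<le> Q i * ((1 / 3) ^ k / 2 * (1 - (1 / 3) ^ m)) + Q i * (1 / 3) ^ (Suc k + m)"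
        by (rule norm_triangle_mono[OF Suc Q_le[OF dS d_small]]) simp
      also have "\<dots> = Q i * ((1 / 3) ^ k / 2 * (1 - (1 / 3) ^ Suc m))"
        by (simp add: power_add field_simps)
      finally show ?case .
    qed simp
    have large: "norm (G (n k) v) \<ge> real (Suc k)" for k
    proof -
      have "(\<lambda>m. G (n k) (x m)) \<longlonglongrightarrow> G (n k) v"
        using v(2) by (intro cont[OF v(1) xL]) (simp add: x_sum)
      then have "(\<lambda>m. G (n k) (x (m + Suc k))) \<longlonglongrightarrow> G (n k) v" by (rule LIMSEQ_ignore_initial_segment)
      then have "(\<lambda>m. norm (G (n k) (x (m + Suc k)) - G (n k) (x (Suc k)))) \<longlonglongrightarrow> norm (G (n k) v - G (n k) (x (Suc k)))"
        by (intro tendsto_intros)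
      then have "norm (G (n k) v - G (n k) (x (Suc k))) \<le> Q (n k) * ((1 / 3) ^ k / 2)"
      proof (rule LIMSEQ_le_const2, intro exI allI impI)
        fix m
        have "Q (n k) * ((1 / 3) ^ k / 2 * (1 - (1 / 3) ^ m)) \<le> Q (n k) * ((1 / 3) ^ k / 2 * 1)"
          by (intro mult_left_mono Q0) auto
        with tail[of "n k" k m] show "norm (G (n k) (x (m + Suc k)) - G (n k) (x (Suc k))) \<le> Q (n k) * ((1 / 3) ^ k / 2)"
          by (simp add: add.commute)
      qed
      moreover have "norm (G (n k) (x (Suc k))) - norm (G (n k) v) \<le> norm (G (n k) v - G (n k) (x (Suc k)))"
        using norm_triangle_ineq2[of "G (n k) (x (Suc k))" "G (n k) v"] by (simp add: norm_minus_commute)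
      ultimately have "(2 / 3) * (1 / 3) ^ k * Q (n k) - Q (n k) * ((1 / 3) ^ k / 2) \<le> norm (G (n k) v)"
        using hump[of k] by linarith
      moreover have "(2 / 3) * (1 / 3) ^ k * Q (n k) - Q (n k) * ((1 / 3) ^ k / 2) = Q (n k) / (6 * 3 ^ k)"
        by (simp add: field_simps)
      moreover have "real (Suc k) \<le> Q (n k) / (6 * 3 ^ k)"
        using n[of k] by (simp add: pos_le_divide_eq mult.commute)
      ultimately show ?thesis by linarith
    qed
    obtain C where C: "\<And>n. norm (G n v) \<le> C" using pointwise[OF v(1)] by blast
    obtain k where "real k > C" using reals_Archimedean2 by blast
    with C[of "n k"] large[of k] show False by simp
  qed
  then obtain C where C: "\<And>n. Q n \<le> C" by blast
  \<comment> \<open>Passage from simple inputs to all: the simple approximants have norm at most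
    \<open>2 * Lp_norm p u\<close>, whence the factor 2, and \<open>G n\<close> is continuous along
    them.\<close>
  have G_less: "norm (G n u) \<le> 2 * C * c" if u: "u \<in> Lp_inputs p" and c: "Lp_norm p u < c" for n u c
  proof -
    obtain s where s: "\<And>i::nat. simple_function ?L (s i)" "\<And>i. s i \<in> Lp_inputs p"
      "\<And>i. Lp_norm p (s i) \<le> 2 * Lp_norm p u" "(\<lambda>i. Lp_norm p (\<lambda>x. u x - s i x)) \<longlonglongrightarrow> 0"
      by (rule Lp_simple_approximation[OF p0 u]) (rule that)
    have c0: "c > 0" using c Lp_norm_nonneg[of p u] by linarith
    have "norm (G n (s i)) \<le> 2 * C * c" for i
    proof -
      have "norm (G n (s i)) \<le> Q n * (2 * c)"
        using s(1,2) order_trans[OF s(3)[of i], of "2 * c"] c c0 by (intro Q_le) (auto simp: S_def)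
      also have "\<dots> \<le> C * (2 * c)" using C c0 by (intro mult_right_mono) auto
      finally show ?thesis by simp
    qed
    then show ?thesis
      using LIMSEQ_le_const2[OF tendsto_norm[OF cont[OF u s(2) s(4)]]] by blast
  qed
  \<comment> \<open>The summand 1 keeps the divisor positive when \<open>C = 0\<close>.\<close>
  have "norm (G n u) \<le> (2 * C + 1) * Lp_norm p u" if u: "u \<in> Lp_inputs p" for n u
  proof -
    have C0: "C \<ge> 0" using C[of 0] Q0[of 0] by linarith
    have "norm (G n u) / (2 * C + 1) \<le> Lp_norm p u"
    proof (rule dense_ge)
      fix c assume c: "Lp_norm p u < c"
      then have c0: "c > 0" using Lp_norm_nonneg[of p u] by linarith
      have "norm (G n u) \<le> 2 * C * c"
        by (rule G_less[OF u c])
      also have "\<dots> \<le> (2 * C + 1) * c" using c0 by (simp add: algebra_simps)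
      finally show "norm (G n u) / (2 * C + 1) \<le> c" using C0 by (simp add: pos_divide_le_eq mult.commute)
    qed
    then show ?thesis using C0 by (simp add: pos_divide_le_eq mult.commute)
  qed
  then show ?thesis by blast
qed

section \<open>Admissible control operators\<close>

context controlled_system
begin

text \<open>Takes the place of a closed graph argument. The operators \<open>S n\<close> composed
  with \<open>W t\<close> are bounded into \<open>X\<close>, since \<open>W t\<close> is bounded
  into the extrapolation space, and their common bound survives the limit.\<close>

lemma W_bounded:
  assumes p: "p \<ge> 1" and adm: "\<And>u. u \<in> Lp_inputs p \<Longrightarrow> W t u \<in> range j" and t: "t \<ge> 0"
  obtains C where "C \<ge> 0" "\<And>u. u \<in> Lp_inputs p \<Longrightarrow> X_norm j (W t u) \<le> C * Lp_norm p u"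
proof -
  obtain S :: "nat \<Rightarrow> _ \<Rightarrow> _" where S: "\<And>n. bounded_linear (S n)" "\<And>x. (\<lambda>n. S n (j x)) \<longlonglongrightarrow> x"
    by (rule approximate_identity) (rule that)
  note loc = Lp_local_input[OF p]
  define G where "G n u = S n (W t u)" for n u
  have "\<exists>C. \<forall>n. \<forall>u\<in>Lp_inputs p. norm (G n u) \<le> C * Lp_norm p u"
  proof (rule Lp_uniform_boundedness[OF p])
    show "G n (\<lambda>s. u s + v s) = G n u + G n v" if "u \<in> Lp_inputs p" "v \<in> Lp_inputs p" for n u v
      by (simp add: G_def W_add loc that linear_add[OF bounded_linear.linear[OF S(1)]])
    show "G n (\<lambda>s. c *\<^sub>R u s) = c *\<^sub>R G n u" if "u \<in> Lp_inputs p" for n u c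
      by (simp add: G_def W_scale loc that linear_scale[OF bounded_linear.linear[OF S(1)]])
    show "\<exists>K. \<forall>u\<in>Lp_inputs p. norm (G n u) \<le> K * Lp_norm p u" for n
    proof -
      obtain K where K: "K \<ge> 0" "\<And>z. norm (S n z) \<le> norm z * K"
        using bounded_linear.nonneg_bounded[OF S(1)[of n]] by blast
      have "norm (G n u) \<le> M * norm B * (t + 1) * K * Lp_norm p u" if u: "u \<in> Lp_inputs p" for u
      proof -
        have "norm (G n u) \<le> norm (W t u) * K" unfolding G_def by (rule K(2))
        also have "\<dots> \<le> (M * norm B * (\<integral>s. norm (u s) \<partial>lebesgue_on {0..t})) * K"
          by (rule mult_right_mono[OF norm_W_le[OF loc[OF u]] K(1)])
        also have "\<dots> \<le> (M * norm B * ((t + 1) * Lp_norm p u)) * K"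
          by (intro mult_right_mono mult_left_mono Lp_integral_le p u t K(1) mult_nonneg_nonneg M_nonneg norm_ge_zero)
        finally show ?thesis by (simp add: mult_ac)
      qed
      then show ?thesis by blast
    qed
    \<comment> \<open>Admissibility enters here: \<open>W t u = j x\<close>, so the sequence
      converges to \<open>x\<close> in \<open>X\<close> and is bounded.\<close>
    show "\<exists>C. \<forall>n. norm (G n u) \<le> C" if u: "u \<in> Lp_inputs p" for u
    proof -
      obtain x where x: "W t u = j x" using adm[OF u] by blast
      have "Bseq (\<lambda>n. G n u)"
        unfolding G_def x by (rule convergent_imp_Bseq[OF convergentI[OF S(2)]])
      then show ?thesis unfolding Bseq_def by blast
    qed
  qed
  then obtain C where C: "\<And>n u. u \<in> Lp_inputs p \<Longrightarrow> norm (G n u) \<le> C * Lp_norm p u" by blast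
  have "X_norm j (W t u) \<le> max C 0 * Lp_norm p u" if u: "u \<in> Lp_inputs p" for u
  proof -
    obtain x where x: "W t u = j x" using adm[OF u] by blast
    have "norm x \<le> C * Lp_norm p u"
      by (rule LIMSEQ_le_const2[OF tendsto_norm[OF S(2)]]) (use C[OF u] in \<open>auto simp: G_def x\<close>)
    also have "\<dots> \<le> max C 0 * Lp_norm p u" by (intro mult_right_mono Lp_norm_nonneg) simp
    finally show ?thesis by (simp add: x)
  qed
  then show ?thesis by (intro that[of "max C 0"]) auto
qed

text \<open>
  Inputs are continued by \<open>0\<close> to the negative half-line, so that the translate by \<open>t - \<tau>\<close> of an
  input reaches at time \<open>\<tau>\<close> the state reached at time \<open>t\<close> by the input itself.
\<close>

lemma W_uniformly_bounded:
  assumes p: "p \<ge> 1" and adm: "\<And>t u. t \<ge> 0 \<Longrightarrow> u \<in> Lp_inputs p \<Longrightarrow> W t u \<in> range j"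
    and \<tau>: "\<tau> > 0" and contraction: "norm (T \<tau>) \<le> 1 / 2"
  obtains C where "C \<ge> 0"
    "\<And>t u. t \<ge> 0 \<Longrightarrow> u \<in> Lp_inputs p \<Longrightarrow> X_norm j (W t u) \<le> C * Lp_norm p u"
proof -
  have p0: "p > 0" using p by simp
  obtain C where C: "C \<ge> 0" "\<And>u. u \<in> Lp_inputs p \<Longrightarrow> X_norm j (W \<tau> u) \<le> C * Lp_norm p u"
    using W_bounded[OF p adm[OF less_imp_le[OF \<tau>]] less_imp_le[OF \<tau>]] by blast
  let ?tr = "\<lambda>c u s. indicator {0..} (s + c) *\<^sub>R u (s + c) :: 'u"
  note loc = Lp_local_input[OF p]
  have tr_bound: "X_norm j (W \<tau> (?tr c u)) \<le> C * Lp_norm p u" if u: "u \<in> Lp_inputs p" for u c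
    using C(2)[OF Lp_inputs_translate[OF p0 u, of c]] Lp_norm_translate_le[OF p0 u, of c] C(1)
    by (meson mult_left_mono order_trans)
  have short: "X_norm j (W t u) \<le> C * Lp_norm p u" if t: "0 \<le> t" "t \<le> \<tau>" and u: "u \<in> Lp_inputs p" for t u
  proof -
    let ?v = "?tr (t - \<tau>) u"
    have v: "?v \<in> Lp_inputs p" by (rule Lp_inputs_translate[OF p0 u])
    \<comment> \<open>At \<open>s = \<tau> - t\<close> the delayed input already takes the value
      \<open>u 0\<close>; only before that point is it zero.\<close>
    have "AE s in lebesgue. s \<noteq> \<tau> - t" by (rule AE_completion) (rule AE_lborel_singleton)
    then have "AE s in lebesgue_on {0..\<tau> - t}. s \<noteq> \<tau> - t"
      by (subst AE_restrict_space_iff) auto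
    then have "AE s in lebesgue_on {0..\<tau> - t}. TX (\<tau> - t - s) (B (?v s)) = TX (\<tau> - t - s) (B 0)"
      using AE_space by eventually_elim (auto simp: indicator_def space_restrict_space)
    from has_banach_integral_cong_AE[OF has_integral_W[OF loc[OF v]] this]
    have "W (\<tau> - t) (\<lambda>s. 0) = W (\<tau> - t) ?v" by (rule W_eqI)
    then have 0: "W (\<tau> - t) ?v = 0" using W_zero by simp
    have "W ((\<tau> - t) + t) ?v = TX t (W (\<tau> - t) ?v) + W t (\<lambda>r. ?v (r + (\<tau> - t)))"
      using t by (intro W_cocycle loc v) auto
    also have "W t (\<lambda>r. ?v (r + (\<tau> - t))) = W t u"
      using loc[OF u] by (intro W_cong) auto
    finally have "W t u = W \<tau> ?v" using 0 by simp
    with tr_bound[OF u] show ?thesis by simp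
  qed
  have short': "X_norm j (W t u) \<le> 2 * C * Lp_norm p u" if "0 \<le> t" "t \<le> \<tau>" "u \<in> Lp_inputs p" for t u
  proof -
    have "C * Lp_norm p u \<ge> 0" by (intro mult_nonneg_nonneg C(1) Lp_norm_nonneg)
    with short[OF that] show ?thesis by simp
  qed
  \<comment> \<open>\<open>2 * C\<close> is the fixed point of the map sending \<open>K\<close> to
    \<open>K / 2 + C\<close>: the contraction halves the bound at time \<open>t - \<tau>\<close>,
    and the input on the last interval of length \<open>\<tau>\<close> adds at most
    \<open>C\<close>. Hence the constant does not grow with \<open>n\<close>.\<close>
  have "X_norm j (W t u) \<le> 2 * C * Lp_norm p u" if "0 \<le> t" "t \<le> real n * \<tau>" and u: "u \<in> Lp_inputs p" for t n u
    using that
  proof (induction n arbitrary: t u)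
    case 0
    then show ?case using short'[of t u] \<tau> by simp
  next
    case (Suc n)
    show ?case
    proof (cases "t \<le> \<tau>")
      case True
      then show ?thesis by (rule short'[OF Suc.prems(1) _ Suc.prems(3)])
    next
      case False
      define r where "r = t - \<tau>"
      have r: "r \<ge> 0" "r \<le> real n * \<tau>" "t = r + \<tau>" using False Suc.prems(2) by (auto simp: r_def algebra_simps)
      obtain x where x: "W r u = j x" using adm[OF r(1) Suc.prems(3)] by blast
      obtain y where y: "W \<tau> (?tr r u) = j y"
        using adm[OF less_imp_le[OF \<tau>] Lp_inputs_translate[OF p0 Suc.prems(3)]] by blast
      have "W t u = TX \<tau> (W r u) + W \<tau> (\<lambda>s. u (s + r))"
        unfolding r(3) using \<tau> r by (intro W_cocycle loc Suc.prems) auto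
      also have "W \<tau> (\<lambda>s. u (s + r)) = W \<tau> (?tr r u)"
        using r by (intro W_cong loc Lp_inputs_translate p0 Suc.prems) auto
      finally have "W t u = j (T \<tau> x + y)"
        using \<tau> by (simp add: x y TX_j linear_add[OF linear_j])
      then have "X_norm j (W t u) \<le> norm (T \<tau> x) + norm y"
        by (simp add: norm_triangle_ineq)
      also have "\<dots> \<le> (1 / 2) * (2 * C * Lp_norm p u) + C * Lp_norm p u"
      proof (rule add_mono)
        have "norm (T \<tau> x) \<le> norm (T \<tau>) * norm x" by (rule norm_blinfun)
        also have "\<dots> \<le> (1 / 2) * norm x" by (intro mult_right_mono contraction) simp
        also have "norm x \<le> 2 * C * Lp_norm p u"
          using Suc.IH[OF r(1,2) Suc.prems(3)] by (simp add: x)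
        finally show "norm (T \<tau> x) \<le> (1 / 2) * (2 * C * Lp_norm p u)" by simp
        show "norm y \<le> C * Lp_norm p u" using tr_bound[OF Suc.prems(3), of r] by (simp add: y)
      qed
      finally show ?thesis by simp
    qed
  qed
  moreover have "\<exists>n. t \<le> real n * \<tau>" for t
    using reals_Archimedean3[OF \<tau>] less_imp_le by blast
  ultimately have "X_norm j (W t u) \<le> 2 * C * Lp_norm p u" if "0 \<le> t" "u \<in> Lp_inputs p" for t u
    using that by blast
  with C(1) show ?thesis by (intro that[of "2 * C"]) auto
qed

end

section \<open>Stability\<close>

lemma class_K_strict: "\<gamma> \<in> class_K \<Longrightarrow> 0 \<le> r \<Longrightarrow> r < s \<Longrightarrow> \<gamma> r < \<gamma> s"
  unfolding class_K_def by (auto intro: strict_mono_onD)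

lemma class_K_mono: "\<gamma> \<in> class_K \<Longrightarrow> 0 \<le> r \<Longrightarrow> r \<le> s \<Longrightarrow> \<gamma> r \<le> \<gamma> s"
  using class_K_strict[of \<gamma> r s] by (cases "r = s") auto

lemma class_K_zero: "\<gamma> \<in> class_K \<Longrightarrow> \<gamma> 0 = 0"
  by (simp add: class_K_def)

lemma class_K_nonneg: "\<gamma> \<in> class_K \<Longrightarrow> r \<ge> 0 \<Longrightarrow> \<gamma> r \<ge> 0"
  using class_K_mono[of \<gamma> 0 r] by (simp add: class_K_zero)

lemma class_K_pos: "\<gamma> \<in> class_K \<Longrightarrow> r > 0 \<Longrightarrow> \<gamma> r > 0"
  using class_K_strict[of \<gamma> 0 r] by (simp add: class_K_zero)

lemma class_K_powr: "p > 0 \<Longrightarrow> (\<lambda>r. r powr p) \<in> class_K"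
  unfolding class_K_def strict_mono_on_def
  by (auto intro!: powr_less_mono2 continuous_on_powr'[OF continuous_on_id continuous_on_const])

lemma class_K_inf_powr:
  assumes q: "q > 0" and c: "c > 0"
  shows "(\<lambda>r. c * r powr q) \<in> class_K_inf"
proof -
  have "(\<lambda>r. c * r powr q) \<in> class_K"
    using class_K_powr[OF q] c by (auto simp: class_K_def strict_mono_on_def intro!: continuous_intros)
  moreover have "\<not> bdd_above ((\<lambda>r. c * r powr q) ` {0..})"
  proof
    assume "bdd_above ((\<lambda>r. c * r powr q) ` {0..})"
    then obtain b where b: "\<And>r. r \<ge> 0 \<Longrightarrow> c * r powr q \<le> b" by (auto simp: bdd_above_def)
    \<comment> \<open>The point at which the function takes the value
      \<open>\<bar>b\<bar> + 1\<close>, beyond the supposed bound.\<close>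
    have "c * (((\<bar>b\<bar> + 1) / c) powr (1 / q)) powr q = \<bar>b\<bar> + 1"
      using q c by (simp add: powr_powr)
    with b[of "((\<bar>b\<bar> + 1) / c) powr (1 / q)"] show False by simp
  qed
  ultimately show ?thesis by (simp add: class_K_inf_def)
qed

text \<open>\<open>\<beta>\<close> need not be linear in the radius, but \<open>T t\<close> is:
  evaluating at unit vectors suffices.\<close>

lemma KL_bound:
  fixes T :: "real \<Rightarrow> 'a::real_normed_vector \<Rightarrow>\<^sub>L 'a"
  assumes \<beta>: "\<beta> \<in> class_KL" and le: "\<And>t x. t \<ge> 0 \<Longrightarrow> norm (T t x) \<le> \<beta> (norm x) t" and t: "t \<ge> 0"
  shows "norm (T t) \<le> \<beta> 1 t"
proof (rule norm_blinfun_bound)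
  have K: "(\<lambda>r. \<beta> r t) \<in> class_K" using \<beta> t by (simp add: class_KL_def)
  then show "0 \<le> \<beta> 1 t" by (rule class_K_nonneg) simp
  fix x
  show "norm (T t x) \<le> \<beta> 1 t * norm x"
  proof (cases "x = 0")
    case False
    have "norm (T t (x /\<^sub>R norm x)) \<le> \<beta> 1 t"
      using le[OF t, of "x /\<^sub>R norm x"] False by simp
    then show ?thesis using False by (simp add: blinfun.scaleR_right field_simps)
  qed (simp add: blinfun.zero_right)
qed

context extrapolated_system
begin

text \<open>The uniform bound \<open>M\<close> is \<open>\<beta> 1 0\<close>, because
  \<open>\<beta> 1\<close> is decreasing in time.\<close>

lemma controlled_systemI:
  assumes \<beta>: "\<beta> \<in> class_KL" and le: "\<And>t x. t \<ge> 0 \<Longrightarrow> norm (T t x) \<le> \<beta> (norm x) t"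
  shows "controlled_system T D A a j (\<beta> 1 0)"
proof unfold_locales
  fix t :: real assume t: "t \<ge> 0"
  have "\<beta> 1 t \<le> \<beta> 1 0"
    using \<beta> t by (cases "t = 0") (auto simp: class_KL_def monotone_on_def less_imp_le)
  with KL_bound[OF \<beta> le t] show "norm (T t) \<le> \<beta> 1 0" by simp
qed

end

theorem proposition3p19:
  fixes T :: "real \<Rightarrow> 'a::banach \<Rightarrow>\<^sub>L 'a"
    and D :: "'a set" and A :: "'a \<Rightarrow> 'a" and a p :: real
    and j :: "'a \<Rightarrow> 'c::banach"
    and B :: "'u::banach \<Rightarrow>\<^sub>L 'c"
  assumes "C0_semigroup T" and "is_generator T D A"
    and "a \<in> resolvent_set D A"
    and "extrapolation_space D A a j"
    and "1 \<le> p"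
  shows "ISS p j T B \<longleftrightarrow> iISS p j T B"
proof -
  interpret extrapolated_system T D A a j
    using assms(1-4) by unfold_locales
  have p0: "p > 0" using assms(5) by simp
  \<comment> \<open>Computed directly, because the calculus of \<open>W\<close> presupposes the
    bound on the semigroup, which is itself read off from the estimate for zero input.\<close>
  have banach_zero: "banach_integral (lebesgue_on {0..t}) (\<lambda>s. extrapolated_semigroup j T (t - s) (B 0)) = 0" for t
  proof (rule banach_integral_eq[OF complete_lebesgue_on])
    show "has_banach_integral (lebesgue_on {0..t}) (\<lambda>s. extrapolated_semigroup j T (t - s) (B 0)) 0"
      using has_banach_integral_zero by (simp add: blinfun.zero_right)
  qed simp
  have free: "X_norm j (mild_solution j T B t x (\<lambda>s. 0)) = norm (T t x)" for t x
    by (simp add: mild_solution_def banach_zero del: blinfun.zero_right)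
  have Lp_zero: "Lp_norm p (\<lambda>s. 0 :: 'u) = 0" using p0 by (simp add: Lp_norm_def)
  show ?thesis
  proof
    assume "ISS p j T B"
    then obtain \<beta> \<gamma> where fc: "forward_complete p j T B" and \<beta>: "\<beta> \<in> class_KL" and \<gamma>: "\<gamma> \<in> class_K_inf"
      and iss: "\<And>x u t. u \<in> Lp_inputs p \<Longrightarrow> t \<ge> 0 \<Longrightarrow>
        X_norm j (mild_solution j T B t x u) \<le> \<beta> (norm x) t + \<gamma> (Lp_norm p u)"
      unfolding ISS_def by blast
    have \<gamma>K: "\<gamma> \<in> class_K" using \<gamma> by (simp add: class_K_inf_def)
    have \<gamma>0: "\<gamma> 0 = 0" using \<gamma>K by (rule class_K_zero)
    have T_le: "norm (T t x) \<le> \<beta> (norm x) t" if "t \<ge> 0" for t x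
      using iss[OF Lp_inputs_zero that, of x] by (simp add: free Lp_zero \<gamma>0)
    interpret controlled_system T D A a j "\<beta> 1 0" B
      by (rule controlled_systemI[OF \<beta> T_le])
    \<comment> \<open>Starting from \<open>x = 0\<close>, the mild solution is
      \<open>W t u\<close>.\<close>
    have adm: "W t u \<in> range j" if "t \<ge> 0" "u \<in> Lp_inputs p" for t u
      using fc that unfolding forward_complete_def mild_solution_W
      by (metis add_cancel_left_left blinfun.zero_right linear_0[OF linear_j])
    \<comment> \<open>Dividing the input by \<open>c\<close> brings it into the unit ball, where the
      gain is at most \<open>\<gamma> 1\<close>; the state scales back linearly.\<close>
    have W_le: "X_norm j (W t u) \<le> \<gamma> 1 * c" if t: "t \<ge> 0" and u: "u \<in> Lp_inputs p" and c: "Lp_norm p u \<le> c" "c > 0" for t u c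
    proof -
      obtain x where x: "W t u = j x" using adm[OF t u] by blast
      have "X_norm j (mild_solution j T B t 0 (\<lambda>s. inverse c *\<^sub>R u s)) \<le> \<beta> (norm (0::'a)) t + \<gamma> (Lp_norm p (\<lambda>s. inverse c *\<^sub>R u s))"
        by (rule iss[OF Lp_inputs_scale[OF p0 u] t])
      also have "mild_solution j T B t 0 (\<lambda>s. inverse c *\<^sub>R u s) = j (inverse c *\<^sub>R x)"
        by (simp add: mild_solution_W W_scale[OF Lp_local_input[OF assms(5) u]] x
            linear_0[OF linear_j] linear_scale[OF linear_j] blinfun.zero_right)
      also have "\<beta> (norm (0::'a)) t = 0" using \<beta> t by (simp add: class_KL_def class_K_def)
      also have "\<gamma> (Lp_norm p (\<lambda>s. inverse c *\<^sub>R u s)) \<le> \<gamma> 1"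
      proof (rule class_K_mono[OF \<gamma>K Lp_norm_nonneg])
        have "Lp_norm p (\<lambda>s. inverse c *\<^sub>R u s) \<le> \<bar>inverse c\<bar> * Lp_norm p u"
          by (rule Lp_norm_scale_le[OF p0 u])
        also have "\<dots> \<le> 1" using c by (simp add: field_simps)
        finally show "Lp_norm p (\<lambda>s. inverse c *\<^sub>R u s) \<le> 1" .
      qed
      finally show ?thesis using c by (simp add: x field_simps)
    qed
    \<comment> \<open>The truncation \<open>v\<close> reaches the same state at time
      \<open>t\<close>, and its norm on the half-line is the integral over \<open>{0..t}\<close>
      that an integral estimate may use.\<close>
    have W_le': "X_norm j (W t u) \<le> \<gamma> 1 * (\<integral>s. norm (u s) powr p \<partial>lebesgue_on {0..t}) powr (1 / p)"
      if t: "t \<ge> 0" and u: "u \<in> Lp_inputs p" for t u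
    proof -
      define v where "v s = indicator {0..t} s *\<^sub>R u s" for s
      have sm: "strongly_measurable (lebesgue_on {0..}) v"
        unfolding v_def using u by (intro strongly_measurable_indicator) (auto simp: Lp_inputs_def sets_restrict_space_iff)
      have v: "v \<in> Lp_inputs p"
        by (rule Lp_mono(1)[OF p0 u sm, of 1]) (auto simp: v_def indicator_def)
      have "W t u = W t v"
        by (rule W_cong[OF _ Lp_local_input[OF assms(5) v]]) (auto simp: v_def)
      moreover have "Lp_norm p v = (\<integral>s. norm (u s) powr p \<partial>lebesgue_on {0..t}) powr (1 / p)"
      proof -
        have restrict: "(\<integral>x. f x \<partial>lebesgue_on V) = (\<integral>x. indicator V x *\<^sub>R f x \<partial>lebesgue)" if "V \<in> sets lebesgue"
          for f :: "real \<Rightarrow> real" and V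
          by (rule integral_restrict_space) (use that in simp)
        have "(\<integral>s. norm (v s) powr p \<partial>lebesgue_on {0..}) = (\<integral>s. norm (u s) powr p \<partial>lebesgue_on {0..t})"
          using p0 by (subst (1 2) restrict) (auto simp: v_def indicator_def intro!: Bochner_Integration.integral_cong)
        then show ?thesis by (simp add: Lp_norm_def)
      qed
      moreover have "X_norm j (W t v) \<le> \<gamma> 1 * Lp_norm p v"
      proof -
        have g: "\<gamma> 1 > 0" by (rule class_K_pos[OF \<gamma>K]) simp
        have "X_norm j (W t v) / \<gamma> 1 \<le> Lp_norm p v"
        proof (rule dense_ge)
          fix c assume "Lp_norm p v < c"
          then show "X_norm j (W t v) / \<gamma> 1 \<le> c"
            using W_le[OF t v, of c] g Lp_norm_nonneg[of p v] by (simp add: pos_divide_le_eq mult.commute)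
        qed
        then show ?thesis using g by (simp add: pos_divide_le_eq mult.commute)
      qed
      ultimately show ?thesis by simp
    qed
    show "iISS p j T B"
      unfolding iISS_def
    proof (intro conjI fc bexI ballI allI impI)
      fix x :: 'a and t :: real and u :: "real \<Rightarrow> 'u" assume u: "u \<in> Lp_inputs p" and t: "t \<ge> 0"
      obtain y where y: "W t u = j y" using adm[OF t u] by blast
      have "X_norm j (mild_solution j T B t x u) \<le> norm (T t x) + norm y"
        by (simp add: mild_solution_W y linear_add[OF linear_j, symmetric] norm_triangle_ineq)
      also have "\<dots> \<le> \<beta> (norm x) t + \<gamma> 1 * (\<integral>s. norm (u s) powr p \<partial>lebesgue_on {0..t}) powr (1 / p)"
        using T_le[OF t, of x] W_le'[OF t u] by (simp add: y)
      finally show "X_norm j (mild_solution j T B t x u) \<le> \<beta> (norm x) t + \<gamma> 1 * (\<integral>s. norm (u s) powr p \<partial>lebesgue_on {0..t}) powr (1 / p)" .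
    next
      show "\<beta> \<in> class_KL" by (rule \<beta>)
      show "(\<lambda>r. r powr p) \<in> class_K" by (rule class_K_powr[OF p0])
      show "(\<lambda>r. \<gamma> 1 * r powr (1 / p)) \<in> class_K_inf"
        using p0 by (intro class_K_inf_powr class_K_pos[OF \<gamma>K]) auto
    qed
  next
    assume "iISS p j T B"
    then obtain \<theta> \<mu> \<beta> where fc: "forward_complete p j T B" and \<theta>: "\<theta> \<in> class_K_inf" and \<mu>: "\<mu> \<in> class_K"
      and \<beta>: "\<beta> \<in> class_KL"
      and iiss: "\<And>x u t. u \<in> Lp_inputs p \<Longrightarrow> t \<ge> 0 \<Longrightarrow> integrable (lebesgue_on {0..t}) (\<lambda>s. \<mu> (norm (u s))) \<Longrightarrow>
        X_norm j (mild_solution j T B t x u) \<le> \<beta> (norm x) t + \<theta> (\<integral>s. \<mu> (norm (u s)) \<partial>lebesgue_on {0..t})"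
      unfolding iISS_def by blast
    have 0: "\<theta> 0 = 0" "\<mu> 0 = 0" using \<theta> \<mu> by (simp_all add: class_K_inf_def class_K_def)
    have T_le: "norm (T t x) \<le> \<beta> (norm x) t" if "t \<ge> 0" for t x
      using iiss[OF Lp_inputs_zero that, of x] by (simp add: free 0)
    interpret controlled_system T D A a j "\<beta> 1 0" B
      by (rule controlled_systemI[OF \<beta> T_le])
    have adm: "W t u \<in> range j" if "t \<ge> 0" "u \<in> Lp_inputs p" for t u
      using fc that unfolding forward_complete_def mild_solution_W
      by (metis add_cancel_left_left blinfun.zero_right linear_0[OF linear_j])
    \<comment> \<open>Decay at radius 1 yields one time at which the semigroup contracts by half; it
      is taken positive so that its multiples exhaust the half-line.\<close>
    have "((\<lambda>t. \<beta> 1 t) \<longlongrightarrow> 0) at_top" using \<beta> by (simp add: class_KL_def)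
    then have "eventually (\<lambda>t. \<beta> 1 t < 1 / 2) at_top" by (rule order_tendstoD) simp
    then have "eventually (\<lambda>t. \<beta> 1 t < 1 / 2 \<and> t > 0) at_top"
      using eventually_gt_at_top by (rule eventually_conj)
    then obtain \<tau> where \<tau>: "\<beta> 1 \<tau> < 1 / 2" "\<tau> > 0"
      by (auto dest: eventually_happens)
    have "norm (T \<tau>) \<le> 1 / 2" using KL_bound[OF \<beta> T_le, of \<tau>] \<tau> by simp
    then obtain C where C: "C \<ge> 0" "\<And>t u. t \<ge> 0 \<Longrightarrow> u \<in> Lp_inputs p \<Longrightarrow> X_norm j (W t u) \<le> C * Lp_norm p u"
      using W_uniformly_bounded[OF assms(5) adm \<tau>(2)] by blast
    show "ISS p j T B"
      unfolding ISS_def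
    proof (intro conjI fc bexI ballI allI impI)
      fix x :: 'a and t :: real and u :: "real \<Rightarrow> 'u" assume u: "u \<in> Lp_inputs p" and t: "t \<ge> 0"
      obtain y where y: "W t u = j y" using adm[OF t u] by blast
      have "X_norm j (mild_solution j T B t x u) \<le> norm (T t x) + norm y"
        by (simp add: mild_solution_W y linear_add[OF linear_j, symmetric] norm_triangle_ineq)
      \<comment> \<open>\<open>C\<close> may be 0, whereas a gain in \<open>class_K_inf\<close>
        needs a positive factor; \<open>powr 1\<close> matches the form of
        \<open>class_K_inf_powr\<close>.\<close>
      also have "\<dots> \<le> \<beta> (norm x) t + (C + 1) * Lp_norm p u powr 1"
        using T_le[OF t, of x] C(2)[OF t u] Lp_norm_nonneg[of p u] by (simp add: y algebra_simps)
      finally show "X_norm j (mild_solution j T B t x u) \<le> \<beta> (norm x) t + (C + 1) * Lp_norm p u powr 1" .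
    next
      show "\<beta> \<in> class_KL" by (rule \<beta>)
      show "(\<lambda>r. (C + 1) * r powr 1) \<in> class_K_inf"
        using C(1) by (intro class_K_inf_powr) auto
    qed
  qed
qed

end
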